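(* Let $n\ge3$, let $U=UT(n,\mathbb{F}_2)$ be the group of upper unitriangular $n\times n$ matrices over $\mathbb{F}_2$, let $I=\{1,\dots,n-1\}$ and $U_i=\langle e_j(1)\mid j\in I\setminus\{i\}\rangle$ for $i\in I$. Then the coset incidence system $(U,(U_i)_{i\in I})$ is an abstract regular polytope of type $\{4^{n-2}\}$, with automorphism group the quotient of the Coxeter group $[4^{n-2}]=\langle s_1,\dots,s_{n-1}\rangle$ by the extra relations $(s_is_{i+1}s_{i+2})^4=1$ for $i\in\{1,\dots,n-3\}$.
   Context: For $1\le i\le n-1$, $e_i(1)$ is the unitriangular matrix with $(i,i+1)$-entry $1$ and all other off-diagonal entries $0$. The Coxeter group $[4^{n-2}]$ is $\langle s_1,\dots,s_{n-1}\mid s_i^2=1,\ (s_is_{i+1})^4=1,\ (s_is_j)^2=1\text{ for }|i-j|\ge2\rangle$. An incidence system over a type set $I$ consists of a set $X$ of elements, a type map $X\to I$, and a symmetric reflexive incidence relation such that distinct incident elements have different types. A flag is a set of pairwise incident elements; its type is the set of types of its elements. It is an incidence geometry if every maximal flag has type $I$. The residue of a flag $F$ is the incidence system of all elements not in $F$ incident to every element of $F$; its rank is $|I|-|F|$. A geometry is residually connected if all residues (including that of the empty flag) of rank at least two have connected incidence graph, and thin if every residue of a flag of rank $|I|-1$ contains exactly two elements. An automorphism is a type-preserving bijection of $X$ respecting incidence (in both directions); the geometry is flag-transitive if its automorphism group is transitive on flags of each given type. A regular hypertope is a thin, residually connected, flag-transitive geometry. The coset incidence system $(G,(G_i)_{i\in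 I})$ has as elements of type $i$ the left cosets $gG_i$ (elements of different types regarded as distinct), with $gG_i$ incident to $kG_j$ iff $gG_i\cap kG_j\ne\emptyset$. An abstract regular polytope is here a regular hypertope with linear Buekenhout diagram, i.e. its types can be ordered $1,\dots,r$ so that the residues of type $\{i,j\}$ are generalized digons (every $i$-element incident to every $j$-element) whenever $|i-j|>1$, and are not generalized digons when $|i-j|=1$. It has type $\{4^{n-2}\}=\{4,\dots,4\}$ ($n-2$ entries, rank $n-1$) if for each $i\in\{1,\dots,n-2\}$ the residues of type $\{i,i+1\}$ have as incidence graph an $8$-cycle (generalized $4$-gon). *)

theory Defs
  imports
    "Jordan_Normal_Form.Matrix"
    "HOL-Library.Z2"
    "HOL-Algebra.Generated_Groups"
    "HOL-Algebra.Left_Coset"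
    "HOL-Algebra.Bij"
begin

section \<open>Incidence geometries\<close>

text \<open>
  The incidence relation is only meaningful on the carrier \<open>elems\<close>; all definitions
  below evaluate it only there.
\<close>

record ('x, 'i) incidence =
  types :: "'i set"
  elems :: "'x set"
  type_of :: "'x \<Rightarrow> 'i"
  inc :: "'x \<Rightarrow> 'x \<Rightarrow> bool"

text \<open>Finiteness of the type set is what makes ranks \<open>card I - card F\<close> meaningful.\<close>

definition incidence_system :: "('x, 'i) incidence \<Rightarrow> bool" where
  "incidence_system \<Gamma> \<longleftrightarrow>
     finite (types \<Gamma>) \<and>
     type_of \<Gamma> ` elems \<Gamma> \<subseteq> types \<Gamma> \<and>
     (\<forall>x \<in> elems \<Gamma>. inc \<Gamma> x x) \<and>
     (\<forall>x \<in> elems \<Gamma>. \<forall>y \<in> elems \<Gamma>. inc \<Gamma> x y \<longrightarrow> inc \<Gamma> y x) \<and>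
     (\<forall>x \<in> elems \<Gamma>. \<forall>y \<in> elems \<Gamma>. inc \<Gamma> x y \<and> x \<noteq> y \<longrightarrow> type_of \<Gamma> x \<noteq> type_of \<Gamma> y)"

definition flag :: "('x, 'i) incidence \<Rightarrow> 'x set \<Rightarrow> bool" where
  "flag \<Gamma> F \<longleftrightarrow> F \<subseteq> elems \<Gamma> \<and> (\<forall>x \<in> F. \<forall>y \<in> F. inc \<Gamma> x y)"

definition maximal_flag :: "('x, 'i) incidence \<Rightarrow> 'x set \<Rightarrow> bool" where
  "maximal_flag \<Gamma> F \<longleftrightarrow> flag \<Gamma> F \<and> (\<forall>F'. flag \<Gamma> F' \<and> F \<subseteq> F' \<longrightarrow> F' = F)"

definition incidence_geometry :: "('x, 'i) incidence \<Rightarrow> bool" where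
  "incidence_geometry \<Gamma> \<longleftrightarrow>
     incidence_system \<Gamma> \<and> (\<forall>F. maximal_flag \<Gamma> F \<longrightarrow> type_of \<Gamma> ` F = types \<Gamma>)"

definition residue :: "('x, 'i) incidence \<Rightarrow> 'x set \<Rightarrow> ('x, 'i) incidence" where
  "residue \<Gamma> F =
     \<lparr>types = types \<Gamma> - type_of \<Gamma> ` F,
      elems = {x \<in> elems \<Gamma>. x \<notin> F \<and> (\<forall>y \<in> F. inc \<Gamma> x y)},
      type_of = type_of \<Gamma>,
      inc = inc \<Gamma>\<rparr>"

definition connected_incidence :: "('x, 'i) incidence \<Rightarrow> bool" where
  "connected_incidence \<Gamma> \<longleftrightarrow> elems \<Gamma> \<noteq> {} \<and>
     (\<forall>x \<in> elems \<Gamma>. \<forall>y \<in> elems \<Gamma>.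
        (x, y) \<in> {(u, v). u \<in> elems \<Gamma> \<and> v \<in> elems \<Gamma> \<and> inc \<Gamma> u v}\<^sup>*)"

definition residually_connected :: "('x, 'i) incidence \<Rightarrow> bool" where
  "residually_connected \<Gamma> \<longleftrightarrow>
     (\<forall>F. flag \<Gamma> F \<and> card F + 2 \<le> card (types \<Gamma>) \<longrightarrow> connected_incidence (residue \<Gamma> F))"

definition thin :: "('x, 'i) incidence \<Rightarrow> bool" where
  "thin \<Gamma> \<longleftrightarrow>
     (\<forall>F. flag \<Gamma> F \<and> card F + 1 = card (types \<Gamma>) \<longrightarrow> card (elems (residue \<Gamma> F)) = 2)"

definition automorphisms :: "('x, 'i) incidence \<Rightarrow> ('x \<Rightarrow> 'x) set" where
  "automorphisms \<Gamma> =
     {f \<in> Bij (elems \<Gamma>).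
        (\<forall>x \<in> elems \<Gamma>. type_of \<Gamma> (f x) = type_of \<Gamma> x) \<and>
        (\<forall>x \<in> elems \<Gamma>. \<forall>y \<in> elems \<Gamma>. inc \<Gamma> (f x) (f y) \<longleftrightarrow> inc \<Gamma> x y)}"

definition automorphism_group :: "('x, 'i) incidence \<Rightarrow> ('x \<Rightarrow> 'x) monoid" where
  "automorphism_group \<Gamma> = BijGroup (elems \<Gamma>) \<lparr>carrier := automorphisms \<Gamma>\<rparr>"

definition flag_transitive :: "('x, 'i) incidence \<Rightarrow> bool" where
  "flag_transitive \<Gamma> \<longleftrightarrow>
     (\<forall>F F'. flag \<Gamma> F \<and> flag \<Gamma> F' \<and> type_of \<Gamma> ` F = type_of \<Gamma> ` F' \<longrightarrow>
        (\<exists>f \<in> automorphisms \<Gamma>. f ` F = F'))"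

definition regular_hypertope :: "('x, 'i) incidence \<Rightarrow> bool" where
  "regular_hypertope \<Gamma> \<longleftrightarrow>
     incidence_geometry \<Gamma> \<and> thin \<Gamma> \<and> residually_connected \<Gamma> \<and> flag_transitive \<Gamma>"


section \<open>Linear diagrams and Schlaefli types\<close>

definition residues_of_type :: "('x, 'i) incidence \<Rightarrow> 'i set \<Rightarrow> ('x, 'i) incidence set" where
  "residues_of_type \<Gamma> J = {residue \<Gamma> F | F. flag \<Gamma> F \<and> type_of \<Gamma> ` F = types \<Gamma> - J}"

definition generalized_digon :: "('x, 'i) incidence \<Rightarrow> 'i \<Rightarrow> 'i \<Rightarrow> bool" where
  "generalized_digon \<Delta> i j \<longleftrightarrow>
     (\<forall>x \<in> elems \<Delta>. \<forall>y \<in> elems \<Delta>. type_of \<Delta> x = i \<and> type_of \<Delta> y = j \<longrightarrow> inc \<Delta> x y)"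

text \<open>The list \<open>ts\<close> is an ordering of the types along which the diagram is linear.\<close>

definition linear_diagram :: "('x, 'i) incidence \<Rightarrow> 'i list \<Rightarrow> bool" where
  "linear_diagram \<Gamma> ts \<longleftrightarrow>
     distinct ts \<and> set ts = types \<Gamma> \<and>
     (\<forall>i j. i < j \<and> j < length ts \<longrightarrow>
        (\<forall>\<Delta> \<in> residues_of_type \<Gamma> {ts ! i, ts ! j}.
           generalized_digon \<Delta> (ts ! i) (ts ! j) \<longleftrightarrow> j \<noteq> Suc i))"

definition abstract_regular_polytope :: "('x, 'i) incidence \<Rightarrow> bool" where
  "abstract_regular_polytope \<Gamma> \<longleftrightarrow> regular_hypertope \<Gamma> \<and> (\<exists>ts. linear_diagram \<Gamma> ts)"

text \<open>The incidence graph (loops from reflexivity discarded) is a cycle with \<open>m\<close> vertices.\<close>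

definition cycle_incidence_graph :: "('x, 'i) incidence \<Rightarrow> nat \<Rightarrow> bool" where
  "cycle_incidence_graph \<Delta> m \<longleftrightarrow>
     (\<exists>c. bij_betw c {..<m} (elems \<Delta>) \<and>
        (\<forall>k < m. \<forall>l < m. k \<noteq> l \<longrightarrow>
           (inc \<Delta> (c k) (c l) \<longleftrightarrow> l = Suc k mod m \<or> k = Suc l mod m)))"

text \<open>Schlaefli type with respect to an ordering \<open>ts\<close> of the types.\<close>

definition has_schlaefli_type :: "('x, 'i) incidence \<Rightarrow> 'i list \<Rightarrow> nat list \<Rightarrow> bool" where
  "has_schlaefli_type \<Gamma> ts ps \<longleftrightarrow>
     linear_diagram \<Gamma> ts \<and> length ts = Suc (length ps) \<and>
     (\<forall>k < length ps. \<forall>\<Delta> \<in> residues_of_type \<Gamma> {ts ! k, ts ! Suc k}.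
        cycle_incidence_graph \<Delta> (2 * ps ! k))"


section \<open>Coset incidence systems\<close>

text \<open>Cosets are tagged by their type, so that elements of different types are distinct.\<close>

definition coset_incidence ::
  "('a, 'b) monoid_scheme \<Rightarrow> 'i set \<Rightarrow> ('i \<Rightarrow> 'a set) \<Rightarrow> ('i \<times> 'a set, 'i) incidence" where
  "coset_incidence G I H =
     \<lparr>types = I,
      elems = (SIGMA i:I. lcosets\<^bsub>G\<^esub> (H i)),
      type_of = fst,
      inc = (\<lambda>x y. snd x \<inter> snd y \<noteq> {})\<rparr>"


section \<open>The unitriangular group over the field with two elements\<close>

definition UT :: "nat \<Rightarrow> bit mat monoid" where
  "UT n =
     \<lparr>carrier = {A \<in> carrier_mat n n. upper_triangular A \<and> (\<forall>k < n. A $$ (k, k) = 1)},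
      mult = (*),
      one = 1\<^sub>m n\<rparr>"

text \<open>
  \<open>transvection n i\<close> is the matrix $e_i(1)$. Matrix positions count from 0, so its
  $(i, i+1)$-entry sits at position \<open>(i - 1, i)\<close>.
\<close>

definition transvection :: "nat \<Rightarrow> nat \<Rightarrow> bit mat" where
  "transvection n i = mat n n (\<lambda>(r, c). if r = c \<or> (Suc r = i \<and> c = i) then 1 else 0)"

definition UT_maximal_parabolic :: "nat \<Rightarrow> nat \<Rightarrow> bit mat set" where
  "UT_maximal_parabolic n i = generate (UT n) (transvection n ` ({1..n - 1} - {i}))"

definition UT_incidence :: "nat \<Rightarrow> (nat \<times> bit mat set, nat) incidence" where
  "UT_incidence n = coset_incidence (UT n) {1..n - 1} (UT_maximal_parabolic n)"


section \<open>Groups given by generators and relations\<close>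

text \<open>
  A letter \<open>(s, True)\<close> stands for the generator \<open>s\<close>, and \<open>(s, False)\<close> for its inverse.
  \<open>word_eq S R\<close> is the least congruence on the words over \<open>S\<close> that cancels mutually
  inverse adjacent letters and makes all relators in \<open>R\<close> trivial.
\<close>

type_synonym 's gword = "('s \<times> bool) list"

definition gwords :: "'s set \<Rightarrow> 's gword set" where
  "gwords S = lists (S \<times> UNIV)"

inductive word_eq :: "'s set \<Rightarrow> 's gword set \<Rightarrow> 's gword \<Rightarrow> 's gword \<Rightarrow> bool" for S R where
  cancel: "s \<in> S \<Longrightarrow> word_eq S R [(s, b), (s, \<not> b)] []"
| relator: "r \<in> R \<Longrightarrow> r \<in> gwords S \<Longrightarrow> word_eq S R r []"
| refl: "w \<in> gwords S \<Longrightarrow> word_eq S R w w"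
| sym: "word_eq S R v w \<Longrightarrow> word_eq S R w v"
| trans: "word_eq S R u v \<Longrightarrow> word_eq S R v w \<Longrightarrow> word_eq S R u w"
| append: "word_eq S R u u' \<Longrightarrow> word_eq S R v v' \<Longrightarrow> word_eq S R (u @ v) (u' @ v')"

definition word_class :: "'s set \<Rightarrow> 's gword set \<Rightarrow> 's gword \<Rightarrow> 's gword set" where
  "word_class S R w = {v. word_eq S R w v}"

definition presented_group :: "'s set \<Rightarrow> 's gword set \<Rightarrow> 's gword set monoid" where
  "presented_group S R =
     \<lparr>carrier = word_class S R ` gwords S,
      mult = (\<lambda>A B. \<Union>u \<in> A. \<Union>v \<in> B. word_class S R (u @ v)),
      one = word_class S R []\<rparr>"

text \<open>The word $(x_1 \cdots x_k)^m$ for a list of generators.\<close>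

definition power_word :: "'s list \<Rightarrow> nat \<Rightarrow> 's gword" where
  "power_word xs m = concat (replicate m (map (\<lambda>s. (s, True)) xs))"

definition coxeter4_relators :: "nat \<Rightarrow> nat gword set" where
  "coxeter4_relators n =
     {power_word [i] 2 | i. i \<in> {1..n - 1}} \<union>
     {power_word [i, i + 1] 4 | i. i \<in> {1..n - 2}} \<union>
     {power_word [i, j] 2 | i j. i \<in> {1..n - 1} \<and> j \<in> {1..n - 1} \<and> \<bar>int i - int j\<bar> \<ge> 2}"

text \<open>The Coxeter group $[4^{n-2}]$ and its generators $s_i$.\<close>

definition coxeter4 :: "nat \<Rightarrow> nat gword set monoid" where
  "coxeter4 n = presented_group {1..n - 1} (coxeter4_relators n)"

definition coxeter4_gen :: "nat \<Rightarrow> nat \<Rightarrow> nat gword set" where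
  "coxeter4_gen n i = word_class {1..n - 1} (coxeter4_relators n) [(i, True)]"

definition normal_closure :: "('a, 'b) monoid_scheme \<Rightarrow> 'a set \<Rightarrow> 'a set" where
  "normal_closure G A = \<Inter> {N. N \<lhd> G \<and> A \<subseteq> N}"

definition coxeter4_extra :: "nat \<Rightarrow> nat gword set set" where
  "coxeter4_extra n =
     {(coxeter4_gen n i \<otimes>\<^bsub>coxeter4 n\<^esub> coxeter4_gen n (i + 1)
        \<otimes>\<^bsub>coxeter4 n\<^esub> coxeter4_gen n (i + 2)) [^]\<^bsub>coxeter4 n\<^esub> (4::nat)
      | i. i \<in> {1..n - 3}}"

end

theory Submission
  imports Defs "Jordan_Normal_Form.Gauss_Jordan_Elimination"
begin

text \<open>
  The transvections $e_1(1), \dots, e_{n-1}(1)$ generate $U = UT(n, \mathbb{F}_2)$, they are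
  involutions, and those with non-adjacent indices commute. For a set $J$ of indices they generate
  the group of all unitriangular matrices whose nonzero entries above the diagonal lie in the
  diagonal blocks determined by $J$ (\<open>generate_transvections\<close>, by row reduction). Membership in
  such a group is a condition on single entries, so these subgroups intersect like the index sets.
  A group with generators of this kind is a string C-group, and the geometry is studied at that
  generality, in the locale \<open>string_C_group\<close>; only the length of the cycles depends on the orders of
  the products of adjacent generators.

  The central fact about the geometry is that pairwise meeting cosets of the maximal parabolic
  subgroups have a common element (\<open>pairwise_meeting_cosets\<close>). The reason is that the diagram is
  linear: a maximal parabolic subgroup $U_m$ is the product of the subgroups generated by the
  generators below and above $m$; these commute, the lower one lies in every $U_b$ with $b > m$ and
  the upper one lies in every $U_a$ with $a < m$. Hence every flag is a set of cosets of one group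
  element, chambers are the same thing as group elements, and the residue of a flag is described
  inside a parabolic subgroup (\<open>residue_elems\<close>). Thinness, connectedness, transitivity, and the
  shape of the rank two residues can then be read off. By thinness an automorphism that fixes a
  chamber fixes the adjacent chambers, so by connectedness it is the identity; therefore the
  automorphism group is $U$ acting by translations (\<open>transl_iso\<close>).

  It remains to see that the Coxeter relations and the relations $(s_i s_{i+1} s_{i+2})^4 = 1$
  present $U$. In any group with elements satisfying them, the iterated commutators
  $[s_i, [s_{i+1}, \dots, s_{i+k}]]$ have square one and commute with $s_i, \dots, s_{i+k}$
  (\<open>root_central\<close>). The extra relations are what is needed for $k = 2$; longer commutators are
  handled by induction. These commutators play the role of the elementary matrices. Writing a matrix
  as a product of its columns, and each column as a product of elementary matrices, gives a normal
  form in the abstract group, and left multiplication by a generator changes it exactly like the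
  corresponding row operation on the matrix (\<open>normal_form_step\<close>). So the value of a word depends
  only on its value in $U$ (\<open>eval_word_normal_form\<close>), which says that the kernel of the
  homomorphism from the Coxeter group onto $U$ is contained in every normal subgroup that contains
  the extra relators.
\<close>

section \<open>String C-groups and their coset geometries\<close>

text \<open>
  The commutation relations make the diagram of the coset geometry linear, and the intersection
  property makes the residue of a flag the coset geometry of a parabolic subgroup.
\<close>

locale string_C_group = group G for G (structure) +
  fixes I :: "nat set" and s :: "nat \<Rightarrow> 'a"
  assumes finite_I: "finite I"
    and s_closed: "i \<in> I \<Longrightarrow> s i \<in> carrier G"
    and s_square: "i \<in> I \<Longrightarrow> s i \<otimes> s i = \<one>"
    and s_nontrivial: "i \<in> I \<Longrightarrow> s i \<noteq> \<one>"
    and s_commute: "i \<in> I \<Longrightarrow> j \<in> I \<Longrightarrow> Suc i < j \<Longrightarrow> s i \<otimes> s j = s j \<otimes> s i"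
    and intersection: "J \<subseteq> I \<Longrightarrow> K \<subseteq> I \<Longrightarrow>
          generate G (s ` J) \<inter> generate G (s ` K) \<subseteq> generate G (s ` (J \<inter> K))"
    and generates: "generate G (s ` I) = carrier G"
begin

definition P :: "nat set \<Rightarrow> 'a set" where
  "P J = generate G (s ` J)"

abbreviation U :: "nat \<Rightarrow> 'a set" where
  "U i \<equiv> P (I - {i})"

definition geom :: "(nat \<times> 'a set, nat) incidence" where
  "geom = coset_incidence G I U"

text \<open>
  Chambers turn out to correspond to group elements; \<open>vert i h\<close> is the element of type \<open>i\<close> in the
  chamber \<open>h\<close>, so \<open>h\<close> matters only up to right multiplication by \<open>U i\<close>.
\<close>

definition vert :: "nat \<Rightarrow> 'a \<Rightarrow> nat \<times> 'a set" where
  "vert i h = (i, h <# U i)"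

lemma inv_cancel:
  assumes "x \<in> carrier G" "y \<in> carrier G"
  shows "inv x \<otimes> (x \<otimes> y) = y" "x \<otimes> (inv x \<otimes> y) = y"
  using assms by (simp_all add: m_assoc [symmetric])

lemma s_inv: "i \<in> I \<Longrightarrow> inv (s i) = s i"
  using inv_equality s_square s_closed by blast

lemma P_subgroup: "J \<subseteq> I \<Longrightarrow> subgroup (P J) G"
  unfolding P_def using generate_is_subgroup s_closed by blast

lemma P_carrier: "J \<subseteq> I \<Longrightarrow> x \<in> P J \<Longrightarrow> x \<in> carrier G"
  using P_subgroup subgroup.mem_carrier by metis

lemma P_mono: "J \<subseteq> K \<Longrightarrow> P J \<subseteq> P K"
  unfolding P_def by (simp add: image_mono mono_generate)

lemma P_mono_mem: "x \<in> P J \<Longrightarrow> J \<subseteq> K \<Longrightarrow> x \<in> P K"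
  using P_mono by blast

lemma P_mult: "J \<subseteq> I \<Longrightarrow> x \<in> P J \<Longrightarrow> y \<in> P J \<Longrightarrow> x \<otimes> y \<in> P J"
  unfolding P_def by (rule generate.eng)

lemma P_inv: "J \<subseteq> I \<Longrightarrow> x \<in> P J \<Longrightarrow> inv x \<in> P J"
  using P_subgroup subgroup.m_inv_closed by metis

lemma P_one: "\<one> \<in> P J"
  unfolding P_def by (rule generate.one)

lemma P_gen: "j \<in> J \<Longrightarrow> s j \<in> P J"
  unfolding P_def by (simp add: generate.incl)

text \<open>
  As the generators are involutions, a parabolic subgroup is exhausted by multiplying generators
  on the right, without inverses. Geometrically this walks along adjacent chambers.
\<close>

lemma P_induct [consumes 2, case_names one step]:
  assumes "J \<subseteq> I" "g \<in> P J" and one: "Q \<one>"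
    and step: "\<And>g j. g \<in> P J \<Longrightarrow> j \<in> J \<Longrightarrow> Q g \<Longrightarrow> Q (g \<otimes> s j)"
  shows "Q g"
proof -
  have "\<forall>k. k \<in> P J \<and> Q k \<longrightarrow> k \<otimes> g \<in> P J \<and> Q (k \<otimes> g)"
    using assms(2)[unfolded P_def]
  proof (induction rule: generate.induct)
    case one
    then show ?case using assms(1) P_carrier by auto
  next
    case (incl h)
    then show ?case using step P_gen P_mult assms(1) by blast
  next
    case (inv h)
    then show ?case using step P_gen P_mult assms(1) s_inv by (metis image_iff subsetD)
  next
    case (eng h1 h2)
    then have "h1 \<in> carrier G" "h2 \<in> carrier G"
      using P_carrier[OF assms(1)] by (auto simp: P_def)
    then show ?case using eng.IH P_carrier[OF assms(1)] m_assoc by metis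
  qed
  then show ?thesis
    using one P_one P_carrier[OF assms(1,2)] by (metis l_one)
qed

lemma P_Int: "J \<subseteq> I \<Longrightarrow> K \<subseteq> I \<Longrightarrow> P J \<inter> P K = P (J \<inter> K)"
  using intersection[of J K, folded P_def] P_mono[of "J \<inter> K" J] P_mono[of "J \<inter> K" K] by blast

lemma mem_P_Diff:
  assumes "K \<subseteq> I" "x \<in> carrier G" "\<And>i. i \<in> K \<Longrightarrow> x \<in> U i"
  shows "x \<in> P (I - K)"
proof -
  have "finite K" using assms(1) finite_I finite_subset by blast
  then show ?thesis
    using assms
  proof (induction K)
    case empty
    then show ?case by (simp add: generates P_def)
  next
    case (insert i K)
    then have "x \<in> P (I - K) \<inter> U i" by auto
    also have "\<dots> = P ((I - K) \<inter> (I - {i}))" by (rule P_Int) auto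
    also have "(I - K) \<inter> (I - {i}) = I - insert i K" by auto
    finally show ?case .
  qed
qed

lemma s_commute': "i \<in> I \<Longrightarrow> j \<in> I \<Longrightarrow> Suc i < j \<or> Suc j < i \<Longrightarrow> s i \<otimes> s j = s j \<otimes> s i"
  using s_commute by metis

text \<open>
  Elements of the two subgroups can be moved past each other, so the letters from \<open>A\<close> in a word can
  be collected on the left.
\<close>

lemma P_commuting_product:
  assumes "A \<subseteq> I" "B \<subseteq> I" and comm: "\<And>i j. i \<in> A \<Longrightarrow> j \<in> B \<Longrightarrow> Suc i < j \<or> Suc j < i"
    and "g \<in> P (A \<union> B)"
  shows "\<exists>x \<in> P A. \<exists>y \<in> P B. g = x \<otimes> y"
proof -
  have pass: "y \<otimes> s i = s i \<otimes> y" if "y \<in> P B" "i \<in> A" for y i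
    using assms(2) that(1)
  proof (induction rule: P_induct)
    case one
    then show ?case using s_closed assms(1) that by auto
  next
    case (step y j)
    have c: "y \<in> carrier G" "s j \<in> carrier G" "s i \<in> carrier G"
      using step P_carrier assms s_closed that by blast+
    have "s j \<otimes> s i = s i \<otimes> s j"
      using comm[OF that(2) step(2)] s_commute' assms(1,2) step that by blast
    then show ?case using c step by (metis m_assoc)
  qed
  have "A \<union> B \<subseteq> I" using assms by auto
  then show ?thesis
    using assms(4)
  proof (induction rule: P_induct)
    case one
    then show ?case using P_one by (metis r_one one_closed)
  next
    case (step g j)
    then obtain x y where xy: "x \<in> P A" "y \<in> P B" "g = x \<otimes> y" by auto
    have c: "x \<in> carrier G" "y \<in> carrier G" "s j \<in> carrier G"
      using xy step P_carrier assms s_closed by blast+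
    show ?case
    proof (cases "j \<in> B")
      case True
      then have "y \<otimes> s j \<in> P B" using xy P_gen P_mult assms by auto
      then show ?thesis using xy c m_assoc by metis
    next
      case False
      then have j: "j \<in> A" using step by auto
      then have "x \<otimes> s j \<in> P A" using xy P_gen P_mult assms by auto
      moreover have "x \<otimes> y \<otimes> s j = (x \<otimes> s j) \<otimes> y"
        using c pass[OF xy(2) j] by (simp add: m_assoc)
      ultimately show ?thesis using xy by blast
    qed
  qed
qed

lemma U_subgroup: "subgroup (U i) G"
  by (rule P_subgroup) auto

lemma mem_coset_iff:
  assumes "g \<in> carrier G"
  shows "x \<in> g <# U i \<longleftrightarrow> x \<in> carrier G \<and> inv g \<otimes> x \<in> U i"
  using assms subgroup.lcos_module_imp[OF U_subgroup is_group]
    subgroup.lcos_module_rev[OF U_subgroup is_group]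
    subgroup.elemlcos_carrier[OF U_subgroup is_group] by blast

lemma coset_eqI: "g \<in> carrier G \<Longrightarrow> x \<in> g <# U i \<Longrightarrow> x <# U i = g <# U i"
  using U_subgroup l_repr_independence by metis

lemma coset_self: "g \<in> carrier G \<Longrightarrow> g \<in> g <# U i"
  using U_subgroup lcos_self by metis

lemma vert_eq_iff: "g \<in> carrier G \<Longrightarrow> h \<in> carrier G \<Longrightarrow> vert i g = vert j h \<longleftrightarrow> i = j \<and> inv g \<otimes> h \<in> U i"
  using coset_eqI coset_self mem_coset_iff unfolding vert_def by (metis prod.inject)

lemma fst_vert [simp]: "fst (vert i g) = i"
  by (simp add: vert_def)

lemma geom_simps:
  "types geom = I" "type_of geom = fst" "elems geom = {vert i h | i h. i \<in> I \<and> h \<in> carrier G}"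
  "inc geom x y \<longleftrightarrow> snd x \<inter> snd y \<noteq> {}"
  unfolding geom_def coset_incidence_def vert_def LCOSETS_def by auto

lemma elemI: "i \<in> I \<Longrightarrow> h \<in> carrier G \<Longrightarrow> vert i h \<in> elems geom"
  by (auto simp: geom_simps(3))

lemma elemE:
  assumes "x \<in> elems geom"
  obtains i h where "x = vert i h" "i \<in> I" "h \<in> carrier G"
  using assms by (auto simp: geom_simps(3))

lemma vert_in_image: "vert j g \<in> (\<lambda>i. vert i h) ` K \<longleftrightarrow> j \<in> K \<and> vert j g = vert j h"
proof
  assume "vert j g \<in> (\<lambda>i. vert i h) ` K"
  then obtain i where i: "i \<in> K" "vert j g = vert i h" by blast
  then have "j = i" using fst_vert by metis
  then show "j \<in> K \<and> vert j g = vert j h" using i by simp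
qed auto

lemma inc_vert_iff:
  assumes "g \<in> carrier G" "h \<in> carrier G"
  shows "inc geom (vert i g) (vert j h) \<longleftrightarrow>
    (\<exists>x \<in> carrier G. inv g \<otimes> x \<in> U i \<and> inv h \<otimes> x \<in> U j)"
  using assms by (auto simp: geom_simps vert_def disjoint_iff mem_coset_iff)

lemma inc_vert_same: "h \<in> carrier G \<Longrightarrow> inc geom (vert i h) (vert j h)"
  unfolding inc_vert_iff using P_one by (intro bexI[of _ h]) auto

text \<open>
  Two cosets of the same subgroup that meet are equal.
\<close>

lemma geom_same_type:
  assumes "x \<in> elems geom" "y \<in> elems geom" "inc geom x y" "fst x = fst y"
  shows "x = y"
proof -
  obtain i g j h where *: "x = vert i g" "y = vert j h" "g \<in> carrier G" "h \<in> carrier G"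
    using assms(1,2) by (metis elemE)
  have "j = i" using assms(4) * by simp
  with assms(3) * obtain z where "z \<in> g <# U i" "z \<in> h <# U i"
    by (auto simp: geom_simps(4) vert_def)
  then have "g <# U i = h <# U i" using coset_eqI * by metis
  then show ?thesis using * \<open>j = i\<close> by (simp add: vert_def)
qed

lemma geom_incidence_system: "incidence_system geom"
  unfolding incidence_system_def
proof (intro conjI ballI impI)
  fix x assume "x \<in> elems geom"
  then show "inc geom x x" using inc_vert_same by (auto simp: geom_simps(3))
next
  fix x y assume "x \<in> elems geom" "y \<in> elems geom" "inc geom x y \<and> x \<noteq> y"
  then show "type_of geom x \<noteq> type_of geom y"
    using geom_same_type[of x y] by (auto simp: geom_simps(2))
qed (auto simp: geom_simps finite_I)

text \<open>
  Induction on the largest type \<open>b\<close>. Let \<open>h\<close> be common to the cosets of smaller types, let \<open>m\<close> be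
  the largest of these types, and let \<open>x\<close> be common to the cosets of types \<open>m\<close> and \<open>b\<close>. Then
  \<open>inv h \<otimes> x\<close> lies in \<open>U m\<close>, hence factors as \<open>r \<otimes> l\<close> with \<open>r\<close> generated above \<open>m\<close> and \<open>l\<close>
  generated below \<open>m\<close>. Now \<open>h \<otimes> r\<close> is common to all cosets: multiplying by \<open>r\<close> does not leave a
  coset of type at most \<open>m\<close>, and \<open>h \<otimes> r\<close> differs from \<open>x\<close> by the element \<open>l\<close> of \<open>U b\<close>.
\<close>

lemma pairwise_meeting_cosets:
  assumes "finite K" "K \<subseteq> I" "\<And>i. i \<in> K \<Longrightarrow> c i \<in> carrier G"
    and "\<And>i j. i \<in> K \<Longrightarrow> j \<in> K \<Longrightarrow> (c i <# U i) \<inter> (c j <# U j) \<noteq> {}"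
  shows "\<exists>h \<in> carrier G. \<forall>i \<in> K. h \<in> c i <# U i"
  using assms
proof (induction K rule: finite_linorder_max_induct)
  case empty
  then show ?case by auto
next
  case (insert b A)
  then obtain h where h: "h \<in> carrier G" "\<And>i. i \<in> A \<Longrightarrow> h \<in> c i <# U i" by (auto simp: Ball_def)
  show ?case
  proof (cases "A = {}")
    case True
    then show ?thesis using insert.prems(2)[of b] coset_self[of "c b" b] by auto
  next
    case False
    define m where "m = Max A"
    have "m \<in> A" using False insert.hyps Max_in[of A] by (simp add: m_def)
    then have m: "m \<in> A" "\<And>i. i \<in> A \<Longrightarrow> i \<le> m" "m < b" "m \<in> I" "b \<in> I"
      using insert.hyps insert.prems(1) by (auto simp: m_def)
    obtain x where x: "x \<in> c m <# U m" "x \<in> c b <# U b"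
      using insert.prems(3)[of m b] m by blast
    have cb: "c b \<in> carrier G" and cm: "c m \<in> carrier G" using insert.prems m by auto
    have xc: "x \<in> carrier G" using x cb mem_coset_iff by auto
    have "x \<in> h <# U m" using coset_eqI[OF cm h(2)[OF m(1)]] x by simp
    then have u: "inv h \<otimes> x \<in> U m" using mem_coset_iff h xc by auto
    have "I - {m} = (I \<inter> {m<..}) \<union> (I \<inter> {..<m})" by auto
    then have "inv h \<otimes> x \<in> P ((I \<inter> {m<..}) \<union> (I \<inter> {..<m}))" using u by simp
    then obtain r l where rl: "r \<in> P (I \<inter> {m<..})" "l \<in> P (I \<inter> {..<m})" "inv h \<otimes> x = r \<otimes> l"
      using P_commuting_product[of "I \<inter> {m<..}" "I \<inter> {..<m}" "inv h \<otimes> x"] m by fastforce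
    have c: "r \<in> carrier G" "l \<in> carrier G"
      using rl P_carrier by (meson Int_lower1)+
    have xr: "x = h \<otimes> r \<otimes> l"
      using rl(3) c h xc by (metis inv_solve_left m_assoc m_closed)
    have "h \<otimes> r \<in> c i <# U i" if "i \<in> insert b A" for i
    proof (cases "i = b")
      case True
      have "inv x \<otimes> (h \<otimes> r) = inv l"
        using xr c h by (simp add: m_assoc inv_cancel inv_mult_group)
      moreover have "inv l \<in> U b"
        using m(3) by (intro P_mono_mem[OF P_inv[OF _ rl(2)]]) auto
      ultimately have "h \<otimes> r \<in> x <# U b" using mem_coset_iff xc h c by auto
      then show ?thesis using True coset_eqI[OF cb x(2)] by simp
    next
      case False
      then have i: "i \<in> A" using that by auto
      have "inv h \<otimes> (h \<otimes> r) = r" using c h by (simp add: m_assoc inv_cancel inv_mult_group)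
      moreover have "r \<in> U i"
        using m(2)[OF i] by (intro P_mono_mem[OF rl(1)]) auto
      ultimately have "h \<otimes> r \<in> h <# U i" using mem_coset_iff h c by auto
      then show ?thesis using coset_eqI[OF _ h(2)[OF i]] insert.prems(2)[of i] i by auto
    qed
    then show ?thesis using h c m_closed by blast
  qed
qed

text \<open>
  A flag is part of a chamber: all its elements are cosets of one group element.
\<close>

lemma flag_common:
  assumes "flag geom F"
  shows "\<exists>h \<in> carrier G. F = (\<lambda>i. vert i h) ` (fst ` F)"
proof -
  have F: "F \<subseteq> elems geom" "\<And>x y. x \<in> F \<Longrightarrow> y \<in> F \<Longrightarrow> inc geom x y"
    using assms by (auto simp: flag_def)
  have ex: "\<forall>i \<in> fst ` F. \<exists>g. g \<in> carrier G \<and> vert i g \<in> F"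
  proof
    fix i assume "i \<in> fst ` F"
    then obtain x where x: "x \<in> F" "fst x = i" by auto
    then obtain j g where "x = vert j g" "g \<in> carrier G" using F(1) by (auto simp: geom_simps(3))
    then show "\<exists>g. g \<in> carrier G \<and> vert i g \<in> F" using x by auto
  qed
  obtain c where c: "\<And>i. i \<in> fst ` F \<Longrightarrow> c i \<in> carrier G \<and> vert i (c i) \<in> F"
    using bchoice[OF ex] by blast
  have I: "fst ` F \<subseteq> I" using F(1) by (auto simp: geom_simps)
  have "\<exists>h \<in> carrier G. \<forall>i \<in> fst ` F. h \<in> c i <# U i"
  proof (rule pairwise_meeting_cosets)
    fix i j assume "i \<in> fst ` F" "j \<in> fst ` F"
    then show "(c i <# U i) \<inter> (c j <# U j) \<noteq> {}"
      using F(2)[of "vert i (c i)" "vert j (c j)"] c by (auto simp: geom_simps vert_def)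
  qed (use I c finite_I finite_subset in auto)
  then obtain h where h: "h \<in> carrier G" "\<And>i. i \<in> fst ` F \<Longrightarrow> h \<in> c i <# U i" by auto
  have *: "x = vert (fst x) h" if "x \<in> F" for x
  proof -
    have "x = vert (fst x) (c (fst x))"
      using that c F by (intro geom_same_type) auto
    also have "\<dots> = vert (fst x) h"
      using that c[of "fst x"] h(1) coset_eqI[OF _ h(2), of "fst x"] by (simp add: vert_def)
    finally show ?thesis .
  qed
  have "F = (\<lambda>x. vert (fst x) h) ` F" using * by (force simp: image_iff)
  then show ?thesis using h(1) by (auto simp: image_image)
qed

lemma chamber_flag: "h \<in> carrier G \<Longrightarrow> K \<subseteq> I \<Longrightarrow> flag geom ((\<lambda>i. vert i h) ` K)"
  by (auto simp: flag_def geom_simps(3) intro: inc_vert_same)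

lemma geom_geometry: "incidence_geometry geom"
  unfolding incidence_geometry_def
proof (intro conjI allI impI geom_incidence_system)
  fix F assume "maximal_flag geom F"
  then have F: "flag geom F" and max: "\<And>F'. flag geom F' \<Longrightarrow> F \<subseteq> F' \<Longrightarrow> F' = F"
    by (auto simp: maximal_flag_def)
  obtain h where h: "h \<in> carrier G" "F = (\<lambda>i. vert i h) ` (fst ` F)"
    using flag_common[OF F] by auto
  have "fst ` F \<subseteq> I" using F by (auto simp: flag_def geom_simps)
  then have "F \<subseteq> (\<lambda>i. vert i h) ` I" using h(2) by blast
  then have "(\<lambda>i. vert i h) ` I = F" using max chamber_flag h by blast
  then show "type_of geom ` F = types geom" by (auto simp: geom_simps image_iff)
qed

lemma flagE:
  assumes "flag geom F"
  obtains h K where "h \<in> carrier G" "K \<subseteq> I" "F = (\<lambda>i. vert i h) ` K" "fst ` F = K" "card F = card K"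
proof -
  obtain h where h: "h \<in> carrier G" "F = (\<lambda>i. vert i h) ` (fst ` F)"
    using flag_common[OF assms] by auto
  have "fst ` F \<subseteq> I" using assms by (auto simp: flag_def geom_simps)
  moreover have "card F = card (fst ` F)"
    proof -
    have v: "x = vert (fst x) h" if "x \<in> F" for x
    proof -
      have "x \<in> (\<lambda>i. vert i h) ` (fst ` F)" using h(2) that by blast
      then show ?thesis by auto
    qed
    have "inj_on fst F" by (rule inj_onI) (use v in metis)
    then show ?thesis by (rule card_image[symmetric])
  qed
  ultimately show ?thesis using that h by blast
qed

text \<open>
  An element incident to the flag extends it to a larger flag, whose common element \<open>k\<close> differs from
  \<open>h\<close> by an element of all the \<open>U i\<close> with \<open>i \<in> K\<close>, that is, of the parabolic subgroup \<open>P (I - K)\<close>.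
\<close>

lemma residue_elems:
  assumes h: "h \<in> carrier G" and K: "K \<subseteq> I"
  shows "elems (residue geom ((\<lambda>i. vert i h) ` K)) = {vert j (h \<otimes> g) | j g. j \<in> I - K \<and> g \<in> P (I - K)}"
    (is "?L = ?R")
proof
  show "?R \<subseteq> ?L"
  proof
    fix x assume "x \<in> ?R"
    then obtain j g where x: "x = vert j (h \<otimes> g)" and *: "j \<in> I" "j \<notin> K" "g \<in> P (I - K)" by auto
    have g: "g \<in> carrier G" using * P_carrier by (metis Diff_subset)
    have "inc geom (vert j (h \<otimes> g)) (vert i h)" if "i \<in> K" for i
    proof -
      have "vert i h = vert i (h \<otimes> g)"
        using h g *(3) subsetD[OF P_mono[of "I - K" "I - {i}"]] that by (auto simp: vert_eq_iff m_assoc inv_cancel inv_mult_group)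
      then show ?thesis using inc_vert_same h g by simp
    qed
    moreover have "vert j (h \<otimes> g) \<notin> (\<lambda>i. vert i h) ` K" using *(2) by (simp add: vert_in_image)
    ultimately show "x \<in> ?L"
      using * g h unfolding x by (auto simp: residue_def geom_simps(3))
  qed
  show "?L \<subseteq> ?R"
  proof
    fix x assume x: "x \<in> ?L"
    let ?F = "(\<lambda>i. vert i h) ` K"
    have x: "x \<in> elems geom" "x \<notin> ?F" "\<And>y. y \<in> ?F \<Longrightarrow> inc geom x y"
      using x by (auto simp: residue_def)
    have F: "?F \<subseteq> elems geom" using h K by (auto simp: geom_simps(3))
    have xK: "fst x \<notin> K"
      proof
      assume a: "fst x \<in> K"
      then have y: "vert (fst x) h \<in> ?F" by simp
      then have "x = vert (fst x) h" using geom_same_type[OF x(1) _ x(3)[OF y]] F by auto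
      then show False using x(2) y by simp
    qed
    have xI: "fst x \<in> I" using x(1) by (auto simp: geom_simps)
    have sym: "inc geom a b \<Longrightarrow> inc geom b a" for a b by (auto simp: geom_simps)
    have "inc geom x x" using x(1) inc_vert_same by (auto simp: geom_simps(3))
    then have "flag geom (insert x ?F)"
      using x F sym inc_vert_same[OF h] by (auto simp: flag_def)
    then obtain k L where k: "k \<in> carrier G" "insert x ?F = (\<lambda>i. vert i k) ` L" by (rule flagE)
    have same: "vert i h = vert i k" if "i \<in> K" for i
    proof -
      have "vert i h \<in> (\<lambda>i. vert i k) ` L" using that k(2) by blast
      then show ?thesis by (simp add: vert_in_image)
    qed
    have "inv h \<otimes> k \<in> P (I - K)"
      proof (rule mem_P_Diff[OF K])
      show "inv h \<otimes> k \<in> U i" if "i \<in> K" for i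
        using same[OF that] h k(1) by (simp add: vert_eq_iff)
    qed (use h k(1) in simp)
    moreover have "x = vert (fst x) k"
    proof -
      have "x \<in> (\<lambda>i. vert i k) ` L" using k(2) by blast
      then show ?thesis by force
    qed
    moreover have "k = h \<otimes> (inv h \<otimes> k)" using h k by (simp add: m_assoc inv_cancel inv_mult_group)
    ultimately have "x = vert (fst x) (h \<otimes> (inv h \<otimes> k))" "fst x \<in> I - K" "inv h \<otimes> k \<in> P (I - K)"
      using xK xI by auto
    then show "x \<in> ?R" by blast
  qed
qed

lemma residue_simps: "inc (residue \<Gamma> F) = inc \<Gamma>" "type_of (residue \<Gamma> F) = type_of \<Gamma>"
  by (simp_all add: residue_def)

lemma P_empty: "P {} = {\<one>}"
  by (simp add: P_def generate_empty)

text \<open>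
  The intersection property makes the generators independent.
\<close>

lemma s_notin_U:
  assumes "i \<in> I" shows "s i \<notin> U i"
proof
  assume "s i \<in> U i"
  then have "s i \<in> P ({i} \<inter> (I - {i}))" using P_Int[of "{i}" "I - {i}"] P_gen assms by blast
  then show False using P_empty s_nontrivial assms by simp
qed

lemma P_single:
  assumes "j \<in> I" shows "P {j} = {\<one>, s j}"
proof
  show "P {j} \<subseteq> {\<one>, s j}"
  proof
    fix g assume "g \<in> P {j}"
    with assms have "{j} \<subseteq> I" "g \<in> P {j}" by auto
    then show "g \<in> {\<one>, s j}"
      by (induction rule: P_induct) (use assms s_square s_closed in auto)
  qed
qed (use P_one P_gen in auto)

lemma geom_thin: "thin geom"
  unfolding thin_def
proof (intro allI impI)
  fix F assume F: "flag geom F \<and> card F + 1 = card (types geom)"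
  then obtain h K where *: "h \<in> carrier G" "K \<subseteq> I" "F = (\<lambda>i. vert i h) ` K" "card F = card K"
    by (metis flagE)
  have "card (I - K) = 1"
    using F * finite_I card_mono[OF finite_I, of K]
    by (auto simp: geom_simps card_Diff_subset finite_subset)
  then obtain j where j: "I - K = {j}" by (auto simp: card_1_singleton_iff)
  then have jI: "j \<in> I" by auto
  have "elems (residue geom F) = {vert j h, vert j (h \<otimes> s j)}"
    proof -
    have "elems (residue geom F) = (\<lambda>g. vert j (h \<otimes> g)) ` {\<one>, s j}"
      unfolding *(3) residue_elems[OF *(1,2)] j P_single[OF jI] by blast
    then show ?thesis using *(1) by simp
  qed
  moreover have "vert j h \<noteq> vert j (h \<otimes> s j)"
    using *(1) s_closed[OF jI] s_notin_U[OF jI] by (simp add: vert_eq_iff m_assoc inv_cancel inv_mult_group)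
  ultimately show "card (elems (residue geom F)) = 2" by simp
qed

text \<open>
  The chambers \<open>h \<otimes> g\<close> and \<open>h \<otimes> g \<otimes> s j\<close> share all their elements of types different from \<open>j\<close>. As the
  residue has rank at least two, such a type \<open>k\<close> is available to pass from one to the other.
\<close>

lemma residue_connected:
  assumes h: "h \<in> carrier G" and K: "K \<subseteq> I" and two: "2 \<le> card (I - K)"
  shows "connected_incidence (residue geom ((\<lambda>i. vert i h) ` K))"
proof -
  let ?D = "residue geom ((\<lambda>i. vert i h) ` K)"
  let ?R = "{(u, v). u \<in> elems ?D \<and> v \<in> elems ?D \<and> inc ?D u v}"
  have el: "elems ?D = {vert j (h \<otimes> g) | j g. j \<in> I - K \<and> g \<in> P (I - K)}"
    by (rule residue_elems[OF h K])
  have gc: "g \<in> carrier G" if "g \<in> P (I - K)" for g using that P_carrier by (metis Diff_subset)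
  have adj: "(vert i (h \<otimes> g), vert j (h \<otimes> g)) \<in> ?R" if "i \<in> I - K" "j \<in> I - K" "g \<in> P (I - K)" for i j g
    using that inc_vert_same[of "h \<otimes> g" i j] gc h unfolding el residue_simps by blast
  obtain i0 where i0: "i0 \<in> I - K" using two by (metis card.empty equals0I not_numeral_le_zero)
  have reach: "(vert i0 h, vert i0 (h \<otimes> g)) \<in> ?R\<^sup>*" if "g \<in> P (I - K)" for g
    using Diff_subset that
  proof (induction rule: P_induct)
    case one
    then show ?case using h by simp
  next
    case (step g j)
    have "\<exists>k \<in> I - K. k \<noteq> j"
      using two by (metis One_nat_def Suc_1 card.empty card_1_singleton_iff card_Suc_eq is_singletonI'
          is_singleton_altdef not_less_eq_eq le_refl empty_iff i0)
    then obtain k where k: "k \<in> I - K" "k \<noteq> j" by auto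
    have gs: "g \<otimes> s j \<in> P (I - K)" "s j \<in> carrier G" "j \<in> I"
      using step P_gen P_mult s_closed by auto
    have "vert k (h \<otimes> g) = vert k (h \<otimes> (g \<otimes> s j))"
    proof -
      have "inv (h \<otimes> g) \<otimes> (h \<otimes> (g \<otimes> s j)) = s j"
        using h gc[OF step(1)] gs by (simp add: m_assoc inv_cancel inv_mult_group)
      moreover have "s j \<in> U k" using k gs P_gen by auto
      ultimately show ?thesis using h gc[OF step(1)] gs by (simp add: vert_eq_iff)
    qed
    then have "(vert i0 (h \<otimes> g), vert k (h \<otimes> g)) \<in> ?R" "(vert k (h \<otimes> g), vert i0 (h \<otimes> (g \<otimes> s j))) \<in> ?R"
      using adj[OF i0 k(1) step(1)] adj[OF k(1) i0 gs(1)] by auto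
    then show ?case using step(3) by (meson rtrancl.rtrancl_into_rtrancl)
  qed
  have rr2: "(vert i0 h, x) \<in> ?R\<^sup>*" if x: "x \<in> elems ?D" for x
  proof -
    obtain j g where jg: "x = vert j (h \<otimes> g)" "j \<in> I - K" "g \<in> P (I - K)"
      using x unfolding el by blast
    show ?thesis
      unfolding jg(1) by (rule rtrancl_into_rtrancl[OF reach[OF jg(3)] adj[OF i0 jg(2,3)]])
  qed
  have "sym ?R" by (rule symI) (auto simp: residue_simps geom_simps(4))
  then have "sym (?R\<^sup>*)" by (rule sym_rtrancl)
  then have sym: "(x, y) \<in> ?R\<^sup>* \<Longrightarrow> (y, x) \<in> ?R\<^sup>*" for x y
    by (rule symD)
  show ?thesis
    unfolding connected_incidence_def
  proof (intro conjI ballI)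
    show "elems ?D \<noteq> {}" using el i0 P_one by blast
    show "(x, y) \<in> ?R\<^sup>*" if "x \<in> elems ?D" "y \<in> elems ?D" for x y
      using rr2[OF that(2)] sym[OF rr2[OF that(1)]] by simp
  qed
qed

lemma geom_residually_connected: "residually_connected geom"
  unfolding residually_connected_def
proof (intro allI impI)
  fix F assume F: "flag geom F \<and> card F + 2 \<le> card (types geom)"
  then obtain h K where *: "h \<in> carrier G" "K \<subseteq> I" "F = (\<lambda>i. vert i h) ` K" "card F = card K"
    by (metis flagE)
  have "2 \<le> card (I - K)"
    using F * finite_I card_mono[OF finite_I, of K]
    by (auto simp: geom_simps card_Diff_subset finite_subset)
  then show "connected_incidence (residue geom F)" using residue_connected * by simp
qed

definition transl :: "'a \<Rightarrow> nat \<times> 'a set \<Rightarrow> nat \<times> 'a set" where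
  "transl g = (\<lambda>x \<in> elems geom. (fst x, g <# snd x))"

lemma transl_vert:
  assumes "i \<in> I" "g \<in> carrier G" "h \<in> carrier G"
  shows "transl g (vert i h) = vert i (g \<otimes> h)"
proof -
  have "U i \<subseteq> carrier G" using P_carrier by blast
  then have "g <# (h <# U i) = (g \<otimes> h) <# U i" using assms by (simp add: lcos_m_assoc)
  then show ?thesis using assms by (auto simp: transl_def geom_simps(3)) (simp add: vert_def)
qed

lemma transl_automorphism:
  assumes g: "g \<in> carrier G" shows "transl g \<in> automorphisms geom"
proof -
  have maps: "transl a x \<in> elems geom" if "a \<in> carrier G" "x \<in> elems geom" for a x
    using that(2) by (rule elemE) (simp add: transl_vert elemI that(1))
  have cancel: "transl (inv a) (transl a x) = x" if "a \<in> carrier G" "x \<in> elems geom" for a x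
    using that(2) by (rule elemE) (simp add: transl_vert that(1) inv_cancel)
  have "bij_betw (transl g) (elems geom) (elems geom)"
    using maps cancel[of g] cancel[of "inv g"] g by (intro bij_betwI[of _ _ _ "transl (inv g)"]) auto
  moreover have "inc geom (transl g x) (transl g y) \<longleftrightarrow> inc geom x y"
    if xy: "x \<in> elems geom" "y \<in> elems geom" for x y
  proof -
    have fwd: "inc geom (transl a x) (transl a y)"
      if a: "a \<in> carrier G" "x \<in> elems geom" "y \<in> elems geom" "inc geom x y" for a x y
    proof -
      obtain i b j c where *: "i \<in> I" "x = vert i b" "b \<in> carrier G" "j \<in> I" "y = vert j c" "c \<in> carrier G"
        using a(2,3) by (metis elemE)
      have "inc geom (vert i b) (vert j c)" using a(4) * by simp
      then obtain z where z: "z \<in> carrier G" "inv b \<otimes> z \<in> U i" "inv c \<otimes> z \<in> U j"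
        unfolding inc_vert_iff[OF *(3,6)] by blast
      have eq: "inv (a \<otimes> d) \<otimes> (a \<otimes> z) = inv d \<otimes> z" if "d \<in> carrier G" for d
        using that z(1) a(1)
        by (simp add: m_assoc inv_cancel inv_mult_group)
      have c: "a \<otimes> b \<in> carrier G" "a \<otimes> c \<in> carrier G" "a \<otimes> z \<in> carrier G" using a(1) * z by auto
      have "inc geom (vert i (a \<otimes> b)) (vert j (a \<otimes> c))"
        unfolding inc_vert_iff[OF c(1,2)]
      proof (rule bexI[OF _ c(3)])
        show "inv (a \<otimes> b) \<otimes> (a \<otimes> z) \<in> U i \<and> inv (a \<otimes> c) \<otimes> (a \<otimes> z) \<in> U j"
          unfolding eq[OF *(3)] eq[OF *(6)] using z by simp
      qed
      then show ?thesis using * a(1) by (simp add: transl_vert)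
    qed
    show ?thesis
      using fwd[OF g xy] fwd[of "inv g" "transl g x" "transl g y"] cancel[OF g] maps[OF g] xy g by auto
  qed
  ultimately show ?thesis
    by (auto simp: automorphisms_def Bij_def) (auto simp: transl_def geom_simps(2))
qed

lemma geom_flag_transitive: "flag_transitive geom"
  unfolding flag_transitive_def
proof (intro allI impI)
  fix F F' assume a: "flag geom F \<and> flag geom F' \<and> type_of geom ` F = type_of geom ` F'"
  then obtain h K where *: "h \<in> carrier G" "K \<subseteq> I" "F = (\<lambda>i. vert i h) ` K" "fst ` F = K"
    by (metis flagE)
  from a obtain h' where **: "h' \<in> carrier G" "F' = (\<lambda>i. vert i h') ` K"
    using * by (metis flagE geom_simps(2))
  have "transl (h' \<otimes> inv h) ` F = F'"
    unfolding * ** image_image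
  proof (rule image_cong)
    fix i assume "i \<in> K"
    then have "transl (h' \<otimes> inv h) (vert i h) = vert i (h' \<otimes> inv h \<otimes> h)"
      using * ** by (intro transl_vert) auto
    then show "transl (h' \<otimes> inv h) (vert i h) = vert i h'" using * ** by (simp add: m_assoc)
  qed simp
  then show "\<exists>f \<in> automorphisms geom. f ` F = F'"
    using transl_automorphism[of "h' \<otimes> inv h"] *(1) **(1) by blast
qed

theorem geom_regular_hypertope: "regular_hypertope geom"
  by (simp add: regular_hypertope_def geom_geometry geom_thin geom_residually_connected
      geom_flag_transitive)

text \<open>
  If an automorphism fixes all elements of a chamber \<open>g\<close>, then it fixes the elements that the
  adjacent chamber \<open>g \<otimes> s j\<close> shares with it. The remaining element of that chamber is the second of
  the two elements of a residue of rank one, the first of which is fixed; so it is fixed as well.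
  All chambers are reached in this way.
\<close>

lemma automorphism_fixing_chamber:
  assumes f: "f \<in> automorphisms geom" and fix1: "\<And>i. i \<in> I \<Longrightarrow> f (vert i \<one>) = vert i \<one>"
    and x: "x \<in> elems geom"
  shows "f x = x"
proof -
  have f_el: "f y \<in> elems geom" if "y \<in> elems geom" for y
    using f that by (auto simp: automorphisms_def Bij_def bij_betw_def)
  have f_inj: "f y = f z \<Longrightarrow> y = z" if "y \<in> elems geom" "z \<in> elems geom" for y z
    using f that by (auto simp: automorphisms_def Bij_def bij_betw_def inj_on_def)
  have f_ty: "fst (f y) = fst y" if "y \<in> elems geom" for y
    using f that by (auto simp: automorphisms_def geom_simps(2))
  have f_inc: "inc geom (f y) (f z) \<longleftrightarrow> inc geom y z" if "y \<in> elems geom" "z \<in> elems geom" for y z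
    using f that by (auto simp: automorphisms_def)
  have all: "\<forall>i \<in> I. f (vert i g) = vert i g" if "g \<in> P I" for g
    using subset_refl that
  proof (induction rule: P_induct)
    case one
    then show ?case using fix1 by simp
  next
    case (step g j)
    have g: "g \<in> carrier G" and sj: "s j \<in> carrier G" and jI: "j \<in> I"
      using step P_carrier s_closed by auto
    have eq: "vert i (g \<otimes> s j) = vert i g" if "i \<in> I" "i \<noteq> j" for i
    proof -
      have "inv g \<otimes> (g \<otimes> s j) \<in> U i" using that g sj jI P_gen by (simp add: m_assoc inv_cancel inv_mult_group)
      then show ?thesis using g sj by (metis vert_eq_iff m_closed)
    qed
    have in_el: "vert i (g \<otimes> s j) \<in> elems geom" "vert i g \<in> elems geom" if "i \<in> I" for i
      using that g sj by (auto simp: geom_simps(3))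
    let ?F = "(\<lambda>i. vert i g) ` (I - {j})"
    let ?y = "vert j (g \<otimes> s j)"
    have "f ?y \<in> elems (residue geom ?F)"
    proof -
      have "inc geom (f ?y) (vert i g)" if "i \<in> I - {j}" for i
      proof -
        have "inc geom ?y (vert i (g \<otimes> s j))" using inc_vert_same g sj by simp
        then have "inc geom ?y (vert i g)" using eq that by simp
        then have "inc geom (f ?y) (f (vert i g))" using f_inc in_el that jI by simp
        then show ?thesis using step that by simp
      qed
      moreover have "f ?y \<notin> ?F" using f_ty[OF in_el(1)[OF jI]] by force
      ultimately show ?thesis using f_el in_el jI by (auto simp: residue_def)
    qed
    moreover have "I - (I - {j}) = {j}" using jI by auto
    ultimately have "f ?y = vert j g \<or> f ?y = ?y"
      using residue_elems[OF g, of "I - {j}"] P_single[OF jI] g by auto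
    moreover have "f ?y \<noteq> vert j g"
    proof
      assume "f ?y = vert j g"
      also have "\<dots> = f (vert j g)" using step jI by simp
      finally have "?y = vert j g" using f_inj in_el jI by blast
      then have "vert j g = ?y" by simp
      then have "inv g \<otimes> (g \<otimes> s j) \<in> U j" using g sj by (simp only: vert_eq_iff m_closed)
      then show False using g sj s_notin_U[OF jI] by (simp add: m_assoc inv_cancel inv_mult_group)
    qed
    ultimately show ?case using eq step by metis
  qed
  then show ?thesis using x generates[folded P_def] by (auto simp: geom_simps(3))
qed

text \<open>
  An automorphism maps the base chamber to some chamber \<open>h\<close>, and composing it with the translation
  by \<open>inv h\<close> yields an automorphism that fixes the base chamber. A translation that acts trivially
  comes from an element of the intersection of all \<open>U i\<close>, which is trivial.
\<close>

theorem transl_iso: "transl \<in> iso G (automorphism_group geom)"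
proof -
  have Bij: "automorphisms geom \<subseteq> Bij (elems geom)" by (auto simp: automorphisms_def)
  have el: "vert i h \<in> elems geom" if "i \<in> I" "h \<in> carrier G" for i h
    using that by (auto simp: geom_simps(3))
  have ext: "f = k" if "f \<in> extensional (elems geom)" "k \<in> extensional (elems geom)"
    "\<And>i h. i \<in> I \<Longrightarrow> h \<in> carrier G \<Longrightarrow> f (vert i h) = k (vert i h)" for f k
    using that by (intro extensionalityI[of _ "elems geom"]) (auto simp: geom_simps(3))
  have tr_ext: "transl g \<in> extensional (elems geom)" for g by (auto simp: transl_def)
  have cmp: "transl (g \<otimes> h) = compose (elems geom) (transl g) (transl h)"
    if "g \<in> carrier G" "h \<in> carrier G" for g h
    using that by (intro ext) (auto simp: tr_ext transl_vert compose_def el m_assoc)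
  have "transl \<in> hom G (automorphism_group geom)"
  proof (rule homI)
    fix g h assume gh: "g \<in> carrier G" "h \<in> carrier G"
    then have "transl g \<in> Bij (elems geom)" "transl h \<in> Bij (elems geom)"
      using transl_automorphism Bij by blast+
    then show "transl (g \<otimes> h) = transl g \<otimes>\<^bsub>automorphism_group geom\<^esub> transl h"
      using gh cmp by (simp add: automorphism_group_def BijGroup_def)
  qed (simp add: automorphism_group_def transl_automorphism)
  moreover have "inj_on transl (carrier G)"
  proof (rule inj_onI)
    fix g h assume gh: "g \<in> carrier G" "h \<in> carrier G" "transl g = transl h"
    have "inv g \<otimes> h \<in> U i" if "i \<in> I" for i
    proof -
      have "vert i g = vert i h"
        using transl_vert[OF that gh(1) one_closed] transl_vert[OF that gh(2) one_closed] gh by simp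
      then show ?thesis using gh by (simp add: vert_eq_iff)
    qed
    then have "inv g \<otimes> h \<in> P (I - I)" using gh by (intro mem_P_Diff[OF subset_refl]) simp_all
    then have "inv g \<otimes> h = \<one>" using P_empty by simp
    then show "g = h" using gh by (metis inv_closed inv_equality inv_inv)
  qed
  moreover have "transl ` carrier G = automorphisms geom"
  proof
    show "automorphisms geom \<subseteq> transl ` carrier G"
    proof
      fix f assume f: "f \<in> automorphisms geom"
      let ?C = "(\<lambda>i. vert i \<one>) ` I"
      have f_el: "f y \<in> elems geom" if "y \<in> elems geom" for y
        using f that by (auto simp: automorphisms_def Bij_def bij_betw_def)
      have f_ty: "fst (f y) = fst y" if "y \<in> elems geom" for y
        using f that by (auto simp: automorphisms_def geom_simps(2))
      have C: "?C \<subseteq> elems geom" using el by auto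
      have "flag geom (f ` ?C)"
        unfolding flag_def
      proof (intro conjI ballI)
        show "f ` ?C \<subseteq> elems geom" using f_el C by blast
        fix x y assume "x \<in> f ` ?C" "y \<in> f ` ?C"
        then obtain i j where ij: "i \<in> I" "x = f (vert i \<one>)" "j \<in> I" "y = f (vert j \<one>)" by auto
        show "inc geom x y"
          using f inc_vert_same[OF one_closed, of i j] ij el
          by (simp add: automorphisms_def)
      qed
      then obtain h where h: "h \<in> carrier G" "f ` ?C = (\<lambda>i. vert i h) ` (fst ` f ` ?C)"
        using flag_common by blast
      have fC: "f (vert i \<one>) = vert i h" if "i \<in> I" for i
      proof -
        have "f (vert i \<one>) \<in> (\<lambda>i. vert i h) ` (fst ` f ` ?C)" using h(2) that by blast
        then show ?thesis using f_ty[OF el[OF that one_closed]] by force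
      qed
      let ?k = "compose (elems geom) (transl (inv h)) f"
      have t: "transl (inv h) \<in> automorphisms geom" using transl_automorphism h by simp
      have "?k \<in> automorphisms geom"
      proof -
        have "?k \<in> Bij (elems geom)" using t f Bij compose_Bij by blast
        then show ?thesis
          using t f f_el by (auto simp: automorphisms_def compose_def)
      qed
      moreover have "?k (vert i \<one>) = vert i \<one>" if "i \<in> I" for i
        using that fC h el by (simp add: compose_def transl_vert)
      ultimately have k: "transl (inv h) (f x) = x" if "x \<in> elems geom" for x
        using automorphism_fixing_chamber[of ?k x] that by (simp add: compose_def)
      have "f = transl h"
      proof (rule ext)
        show "f \<in> extensional (elems geom)" using f Bij Bij_imp_extensional by blast
        fix i g assume ig: "i \<in> I" "g \<in> carrier G"
        obtain j g' where j: "f (vert i g) = vert j g'" "j \<in> I" "g' \<in> carrier G"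
          using f_el[OF el[OF ig]] by (auto simp: geom_simps(3))
        have "vert i g = vert j (inv h \<otimes> g')"
          using k[OF el[OF ig]] j h transl_vert by simp
        then have "transl h (vert i g) = vert j (h \<otimes> (inv h \<otimes> g'))"
          using transl_vert[of j h "inv h \<otimes> g'"] j h by simp
        then show "f (vert i g) = transl h (vert i g)"
          using j h by (simp add: m_assoc inv_cancel inv_mult_group)
      qed (rule tr_ext)
      then show "f \<in> transl ` carrier G" using h by blast
    qed
  qed (use transl_automorphism in blast)
  ultimately show ?thesis
    by (simp add: iso_def bij_betw_def automorphism_group_def)
qed


section \<open>Residues of rank two\<close>

lemma residues_of_typeE:
  assumes "\<Delta> \<in> residues_of_type geom J" "J \<subseteq> I"
  obtains h where "h \<in> carrier G" "\<Delta> = residue geom ((\<lambda>i. vert i h) ` (I - J))"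
    "elems \<Delta> = {vert j (h \<otimes> g) | j g. j \<in> J \<and> g \<in> P J}"
proof -
  obtain F where F: "flag geom F" "fst ` F = I - J" "\<Delta> = residue geom F"
    using assms(1) by (auto simp: residues_of_type_def geom_simps)
  obtain h K where *: "h \<in> carrier G" "F = (\<lambda>i. vert i h) ` K" "fst ` F = K"
    using F(1) by (metis flagE)
  have K: "K = I - J" using * F(2) by simp
  have "I - (I - J) = J" using assms(2) by auto
  then have "elems \<Delta> = {vert j (h \<otimes> g) | j g. j \<in> J \<and> g \<in> P J}"
    unfolding F(3) *(2) K residue_elems[OF *(1) Diff_subset] by simp
  then show ?thesis using that[OF *(1)] F(3) *(2) K by simp
qed

text \<open>
  Inside a residue of rank two an element of type \<open>i\<close> lies in exactly the two chambers \<open>g\<close> and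
  \<open>g \<otimes> s j\<close>. Two elements of different types are incident if and only if they lie in a common
  chamber, because together with the flag they form a flag, which has a common group element.
\<close>

lemma inc_in_residue_iff:
  assumes h: "h \<in> carrier G" and ij: "i \<in> I" "j \<in> I" "i \<noteq> j" and g: "g \<in> P {i, j}" "k \<in> P {i, j}"
  shows "inc geom (vert i (h \<otimes> g)) (vert j (h \<otimes> k)) \<longleftrightarrow>
    (\<exists>x \<in> {g, g \<otimes> s j}. x \<in> {k, k \<otimes> s i})"
proof -
  have J: "{i, j} \<subseteq> I" using ij by auto
  have gc: "g \<in> carrier G" "k \<in> carrier G" using g P_carrier[OF J] by auto
  have mem: "g' \<in> carrier G \<Longrightarrow> a \<in> I \<Longrightarrow> inv g' \<otimes> x \<in> P {a} \<Longrightarrow> x \<in> carrier G \<Longrightarrow> x \<in> {g', g' \<otimes> s a}" for g' a x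
    using P_single[of a] inv_cancel[of g' x] by auto
  have mem': "inv g' \<otimes> x \<in> U b" if "g' \<in> carrier G" "a \<in> I" "a \<noteq> b" "x \<in> {g', g' \<otimes> s a}" for g' a b x
    using that P_one P_gen[of a "I - {b}"] s_closed[of a] by (auto simp: inv_cancel)
  show ?thesis
  proof
    assume inc: "inc geom (vert i (h \<otimes> g)) (vert j (h \<otimes> k))"
    let ?C = "(\<lambda>l. vert l h) ` (I - {i, j})"
    have res: "vert i (h \<otimes> g) \<in> elems (residue geom ?C)" "vert j (h \<otimes> k) \<in> elems (residue geom ?C)"
      using residue_elems[OF h, of "I - {i, j}"] ij g double_diff[OF J subset_refl] by auto
    let ?F = "insert (vert i (h \<otimes> g)) (insert (vert j (h \<otimes> k)) ?C)"
    have sym: "inc geom a b \<Longrightarrow> inc geom b a" for a b by (auto simp: geom_simps)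
    have "flag geom ?F"
      using inc res sym inc_vert_same[OF h] inc_vert_same[of "h \<otimes> g"] inc_vert_same[of "h \<otimes> k"] h gc
      unfolding flag_def residue_def by (auto simp: elemI)
    then obtain y L where y: "y \<in> carrier G" "?F = (\<lambda>l. vert l y) ` L" by (rule flagE)
    have same: "vert l x = vert l y" if "vert l x \<in> ?F" for l x
      using that unfolding y(2) vert_in_image by blast
    have z: "inv h \<otimes> y \<in> P (I - (I - {i, j}))"
    proof (rule mem_P_Diff)
      show "inv h \<otimes> y \<in> U l" if "l \<in> I - {i, j}" for l
        using same[of l h] that h y(1) by (auto simp: vert_eq_iff)
    qed (use h y in auto)
    then have zJ: "inv h \<otimes> y \<in> P {i, j}" using double_diff[OF J subset_refl] by simp
    let ?z = "inv h \<otimes> y"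
    have "inv g \<otimes> ?z \<in> U i" "inv k \<otimes> ?z \<in> U j"
      using same[of i "h \<otimes> g"] same[of j "h \<otimes> k"] h y(1) gc
      by (simp_all add: vert_eq_iff inv_mult_group m_assoc)
    moreover have "inv g \<otimes> ?z \<in> P {i, j}" "inv k \<otimes> ?z \<in> P {i, j}"
      using zJ g P_mult[OF J] P_inv[OF J] by auto
    moreover have "{i, j} \<inter> (I - {i}) = {j}" "{i, j} \<inter> (I - {j}) = {i}" using ij by auto
    ultimately have "inv g \<otimes> ?z \<in> P {j}" "inv k \<otimes> ?z \<in> P {i}"
      using P_Int[OF J, of "I - {i}"] P_Int[OF J, of "I - {j}"] by auto
    then have "?z \<in> {g, g \<otimes> s j}" "?z \<in> {k, k \<otimes> s i}"
      using mem gc ij h y(1) by auto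
    then show "\<exists>x \<in> {g, g \<otimes> s j}. x \<in> {k, k \<otimes> s i}" by blast
  next
    assume "\<exists>x \<in> {g, g \<otimes> s j}. x \<in> {k, k \<otimes> s i}"
    then obtain x where x: "x \<in> {g, g \<otimes> s j}" "x \<in> {k, k \<otimes> s i}" by blast
    have xc: "x \<in> carrier G" using x gc ij s_closed by auto
    have "vert i (h \<otimes> g) = vert i (h \<otimes> x)" "vert j (h \<otimes> k) = vert j (h \<otimes> x)"
      using mem'[of g j i x] mem'[of k i j x] x xc gc h ij
      by (simp_all add: vert_eq_iff inv_mult_group m_assoc inv_cancel)
    then show "inc geom (vert i (h \<otimes> g)) (vert j (h \<otimes> k))"
      using inc_vert_same h xc by simp
  qed
qed

text \<open>
  If the two generators commute, then \<open>P {i, j}\<close> is the product of \<open>P {j}\<close> and \<open>P {i}\<close> in this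
  order, and this puts any two elements of different types into a common chamber.
\<close>

lemma residue_digon:
  assumes ij: "i \<in> I" "j \<in> I" "Suc i < j" and "\<Delta> \<in> residues_of_type geom {i, j}"
  shows "generalized_digon \<Delta> i j"
proof -
  have J: "{i, j} \<subseteq> I" using ij by auto
  obtain h where h: "h \<in> carrier G" "\<Delta> = residue geom ((\<lambda>l. vert l h) ` (I - {i, j}))"
    and el: "elems \<Delta> = {vert l (h \<otimes> g) | l g. l \<in> {i, j} \<and> g \<in> P {i, j}}"
    by (rule residues_of_typeE[OF assms(4) J])
  have "inc geom (vert i (h \<otimes> g)) (vert j (h \<otimes> k))" if "g \<in> P {i, j}" "k \<in> P {i, j}" for g k
  proof -
    have gk: "inv g \<otimes> k \<in> P ({j} \<union> {i})"
      using that P_mult[OF J] P_inv[OF J] by (simp add: insert_commute)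
    obtain a b where ab: "a \<in> P {j}" "b \<in> P {i}" "inv g \<otimes> k = a \<otimes> b"
      using P_commuting_product[OF _ _ _ gk] ij by auto
    have c: "g \<in> carrier G" "k \<in> carrier G" "a \<in> carrier G" "b \<in> carrier G"
      using that P_carrier[OF J] P_carrier[of "{i}"] P_carrier[of "{j}"] ab ij by auto
    have "k = g \<otimes> (a \<otimes> b)" using ab c inv_cancel by metis
    moreover have "b = \<one> \<or> b = s i" using ab(2) P_single ij by auto
    ultimately have "g \<otimes> a \<in> {k, k \<otimes> s i}"
      using c ij s_closed s_square by (auto simp: m_assoc)
    moreover have "g \<otimes> a \<in> {g, g \<otimes> s j}" using ab(1) P_single ij c by auto
    ultimately show ?thesis using inc_in_residue_iff[OF h(1) ij(1,2) _ that] ij by auto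
  qed
  note digon = this
  show ?thesis
    unfolding generalized_digon_def
  proof (intro ballI impI)
    fix x y assume "x \<in> elems \<Delta>" "y \<in> elems \<Delta>" and t: "type_of \<Delta> x = i \<and> type_of \<Delta> y = j"
    then obtain l g m k where xy: "x = vert l (h \<otimes> g)" "g \<in> P {i, j}" "y = vert m (h \<otimes> k)" "k \<in> P {i, j}"
      unfolding el by blast
    have "l = i" "m = j" using t xy by (auto simp: h(2) residue_simps geom_simps(2))
    then show "inc \<Delta> x y" using digon[OF xy(2,4)] xy(1,3) by (simp add: h(2) residue_simps)
  qed
qed

lemma vert_in_residue_eq_iff:
  assumes h: "h \<in> carrier G" and ij: "i \<in> I" "j \<in> I" "i \<noteq> j" and g: "g \<in> P {i, j}" "k \<in> P {i, j}"
  shows "vert i (h \<otimes> g) = vert i (h \<otimes> k) \<longleftrightarrow> k \<in> {g, g \<otimes> s j}"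
proof -
  have J: "{i, j} \<subseteq> I" using ij by auto
  have gc: "g \<in> carrier G" "k \<in> carrier G" using g P_carrier[OF J] by auto
  have "vert i (h \<otimes> g) = vert i (h \<otimes> k) \<longleftrightarrow> inv g \<otimes> k \<in> U i"
    using h gc by (simp add: vert_eq_iff inv_mult_group m_assoc inv_cancel)
  also have "\<dots> \<longleftrightarrow> inv g \<otimes> k \<in> P {i, j} \<inter> U i"
    using g P_mult[OF J] P_inv[OF J] by auto
  also have "P {i, j} \<inter> U i = P ({i, j} \<inter> (I - {i}))" using J by (intro P_Int) auto
  also have "{i, j} \<inter> (I - {i}) = {j}" using ij by auto
  also have "inv g \<otimes> k \<in> P {j} \<longleftrightarrow> k \<in> {g, g \<otimes> s j}"
    proof
    assume "inv g \<otimes> k \<in> P {j}"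
    then have "g \<otimes> (inv g \<otimes> k) \<in> {g \<otimes> \<one>, g \<otimes> s j}" using P_single[OF ij(2)] by auto
    then show "k \<in> {g, g \<otimes> s j}" using gc by (simp add: inv_cancel)
  next
    assume "k \<in> {g, g \<otimes> s j}"
    then have "inv g \<otimes> k = \<one> \<or> inv g \<otimes> k = s j"
      using gc inv_cancel(1)[OF gc(1) s_closed[OF ij(2)]] by fastforce
    then show "inv g \<otimes> k \<in> P {j}" using P_single[OF ij(2)] by auto
  qed
  finally show ?thesis .
qed

text \<open>
  The prefixes $1, a, ab, aba, \dots$ of the alternating word are the successive chambers met when
  walking around a residue of rank two.
\<close>

primrec alternating :: "'a \<Rightarrow> 'a \<Rightarrow> nat \<Rightarrow> 'a" where
  "alternating a b 0 = \<one>"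
| "alternating a b (Suc k) = alternating a b k \<otimes> (if even k then a else b)"

text \<open>
  The dihedral group generated by \<open>s i\<close> and \<open>s j\<close> has order eight, and the prefixes of the
  alternating word of length eight run through it once. The \<open>k\<close>-th vertex of the cycle is the element
  that the \<open>k\<close>-th and the next chamber have in common; its type alternates with the parity of \<open>k\<close>.
  Two vertices are incident if and only if the corresponding pairs of chambers overlap.
\<close>

lemma residue_octagon:
  assumes ij: "i \<in> I" "j \<in> I" "i \<noteq> j" and "\<Delta> \<in> residues_of_type geom {i, j}"
    and order4: "(s i \<otimes> s j) [^] (4::nat) = \<one>" "(s i \<otimes> s j) [^] (2::nat) \<noteq> \<one>"
  shows "cycle_incidence_graph \<Delta> 8" "\<not> generalized_digon \<Delta> i j"
proof -
  have J: "{i, j} \<subseteq> I" using ij by auto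
  obtain h where h: "h \<in> carrier G" "\<Delta> = residue geom ((\<lambda>l. vert l h) ` (I - {i, j}))"
    and el: "elems \<Delta> = {vert l (h \<otimes> g) | l g. l \<in> {i, j} \<and> g \<in> P {i, j}}"
    by (rule residues_of_typeE[OF assms(4) J])
  define a b where "a = s i" and "b = s j"
  have ab: "a \<in> carrier G" "b \<in> carrier G" "a \<otimes> a = \<one>" "b \<otimes> b = \<one>"
    using ij s_closed s_square by (auto simp: a_def b_def)
  define x where "x = a \<otimes> b"
  have x: "x \<in> carrier G" "x [^] (4::nat) = \<one>" "x [^] (2::nat) \<noteq> \<one>"
    using ab order4 by (auto simp: x_def a_def b_def)
  \<comment> \<open>the generator leading from chamber \<open>k\<close> to the next one, and the type of the element they share\<close>
  define st where "st k = (if even k then i else j)" for k :: nat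
  define ty where "ty k = (if even k then j else i)" for k :: nat
  let ?d = "alternating a b"
  have d_Suc: "?d (Suc k) = ?d k \<otimes> s (st k)" for k by (simp add: st_def a_def b_def)
  have dP: "?d k \<in> P {i, j}" for k
    by (induction k) (auto simp: P_one a_def b_def intro!: P_mult[OF J] P_gen)
  have dc: "?d k \<in> carrier G" for k using dP P_carrier[OF J] by blast
  have d_even: "?d (2 * q) = x [^] q" for q
    by (induction q) (auto simp: x_def m_assoc ab dc)
  have d_add: "?d (k + m) = ?d k \<otimes> ?d m" if "even k" for k m
    by (induction m) (use that ab in \<open>auto simp: dc m_assoc\<close>)
  have d_ne: "?d m \<noteq> \<one>" if m: "0 < m" "m < 8" for m
  proof
    assume d1: "?d m = \<one>"
    show False
    proof (cases "even m")
      case True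
      then obtain q where q: "m = 2 * q" by blast
      then have "q \<in> {1, 2, 3}" using m by auto
      moreover have "x [^] q = \<one>" using d1 d_even q by simp
      ultimately have "x = \<one> \<or> x [^] (2::nat) = \<one> \<or> x [^] (3::nat) = \<one>" using x(1) by auto
      moreover have "x [^] (4::nat) = x [^] (3::nat) \<otimes> x"
        using nat_pow_Suc[of x 3] by (simp add: eval_nat_numeral)
      moreover have "x = \<one> \<Longrightarrow> x [^] (2::nat) = \<one>" by simp
      ultimately show False using x by (metis l_one)
    next
      case False
      then obtain q where q: "m = Suc (2 * q)" by (metis oddE Suc_eq_plus1)
      then have "x [^] q \<otimes> a = \<one>" using d1 d_even[of q] by simp
      moreover have "x [^] q \<otimes> a \<otimes> a = x [^] q" using ab x(1) by (simp add: m_assoc)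
      ultimately have xa: "x [^] q = a" using ab by simp
      \<comment> \<open>now a is a power of x, hence commutes with x = ab, which makes ab an involution\<close>
      have "a \<otimes> x = x \<otimes> a"
        unfolding xa[symmetric] using x(1) by (metis nat_pow_Suc nat_pow_Suc2)
      then have "a \<otimes> x \<otimes> b = x \<otimes> a \<otimes> b" by simp
      also have "\<dots> = x \<otimes> x" using ab x(1) unfolding x_def by (simp add: m_assoc)
      finally have "a \<otimes> x \<otimes> b = x \<otimes> x" .
      moreover have "a \<otimes> x \<otimes> b = \<one>" using ab by (simp add: x_def m_assoc[symmetric])
      ultimately show False using x by (simp add: numeral_eq_Suc)
    qed
  qed
  have d8: "?d 8 = \<one>" using d_even[of 4] x by simp
  have d_period: "?d (k + 8) = ?d k" for k
    using d_add[of 8 k] d8 dc by (simp add: add.commute)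
  have par8: "even (k mod 8) \<longleftrightarrow> even k" for k :: nat
    by (rule dvd_mod_iff) simp
  have m78: "Suc (k + 7) = k + 8" for k :: nat by simp
  have d_period': "?d (k + 8 * q) = ?d k" for k q
  proof (induction q)
    case (Suc q)
    have "k + 8 * Suc q = (k + 8 * q) + 8" by simp
    then show ?case using Suc d_period by metis
  qed simp
  have d_mod: "?d (k mod 8) = ?d k" for k
    using d_period'[of "k mod 8" "k div 8"] by simp
  \<comment> \<open>From an even position on, the alternating word starts again with \<open>a\<close>; adding a multiple of the
    period to \<open>l\<close> makes \<open>l\<close> at least \<open>k\<close> and avoids truncated subtraction.\<close>
  have d_inj_even: "k mod 8 = l mod 8" if "even k" "?d k = ?d l" for k l
  proof -
    define m where "m = l + 8 * k - k"
    have km: "k + m = l + 8 * k" by (simp add: m_def)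
    have "?d (k + m) = ?d k" unfolding km using that(2) d_period'[of l k] by simp
    then have "?d m = \<one>" using d_add[OF that(1), of m] dc by (metis l_cancel_one)
    then have "?d (m mod 8) = \<one>" using d_mod[of m] by simp
    moreover have "m mod 8 < 8" by simp
    ultimately have "m mod 8 = 0" using d_ne[of "m mod 8"] by blast
    then have "(k + m) mod 8 = k mod 8" by (metis add.right_neutral mod_add_right_eq)
    then show ?thesis unfolding km by simp
  qed
  have d_inj: "k mod 8 = l mod 8" if "?d k = ?d l" for k l
  proof (cases "even k \<or> even l")
    case True
    then show ?thesis using d_inj_even that by metis
  next
    case False
    then have "?d (Suc k) = ?d (Suc l)" using that by simp
    then have "Suc k mod 8 = Suc l mod 8" using d_inj_even[of "Suc k" "Suc l"] False by simp
    then show ?thesis by (simp add: mod_Suc split: if_splits)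
  qed
  have d_eq: "?d k = ?d l \<longleftrightarrow> k mod 8 = l mod 8" for k l
    using d_inj d_mod by metis
  have all_d: "\<exists>m. g = ?d m" if "g \<in> P {i, j}" for g
    using J that
  proof (induction rule: P_induct)
    case one
    then show ?case by (metis alternating.simps(1))
  next
    case (step g l)
    then obtain m where m: "g = ?d m" by blast
    show ?case
    proof (cases "l = st m")
      case True
      then show ?thesis using m d_Suc by metis
    next
      case False
      then have l: "l = st (m + 7)" using step(2) by (auto simp: st_def)
      have "?d (m + 7) \<otimes> s l = ?d m"
        unfolding l d_Suc[symmetric] using d_period[of m] m78 by metis
      moreover have "s l \<in> carrier G" "s l \<otimes> s l = \<one>" using step(2) ij s_closed s_square by auto
      ultimately have "g \<otimes> s l = ?d (m + 7)" using m dc[of "m + 7"] by (simp add: m_assoc flip: \<open>?d (m + 7) \<otimes> s l = ?d m\<close>)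
      then show ?thesis by blast
    qed
  qed
  define c where "c k = vert (ty k) (h \<otimes> ?d k)" for k
  have ty_st: "ty k \<in> I" "st k \<in> I" "ty k \<noteq> st k" "{ty k, st k} = {i, j}" for k
    using ij by (auto simp: ty_def st_def)
  have same_ty: "vert (ty k) (h \<otimes> ?d l) = vert (ty k) (h \<otimes> ?d m) \<longleftrightarrow> ?d m \<in> {?d l, ?d l \<otimes> s (st k)}"
    for k l m using vert_in_residue_eq_iff[OF h(1) ty_st(1-3)] dP ty_st(4) by simp
  have c_eq: "c k = c l \<longleftrightarrow> k mod 8 = l mod 8" for k l
  proof
    assume "c k = c l"
    then have t: "ty k = ty l" unfolding c_def by (metis fst_vert)
    then have par: "even k = even l" using ij by (auto simp: ty_def split: if_splits)
    have "?d l \<in> {?d k, ?d (Suc k)}"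
      using \<open>c k = c l\<close> same_ty[of k k l] unfolding c_def t[symmetric] d_Suc by simp
    then have "l mod 8 = k mod 8 \<or> l mod 8 = Suc k mod 8"
      using d_eq[of l k] d_eq[of l "Suc k"] by blast
    then show "k mod 8 = l mod 8" using par par8 even_Suc by metis
  next
    assume "k mod 8 = l mod 8"
    moreover from this have "even k = even l" using par8 by metis
    ultimately show "c k = c l" using d_eq[of k l] by (simp add: c_def ty_def)
  qed
  have c_el: "c k \<in> elems \<Delta>" for k
    unfolding el c_def using dP ty_st(4)[of k] by blast
  have c_inc: "inc geom (c k) (c l) \<longleftrightarrow> l = Suc k mod 8 \<or> k = Suc l mod 8"
    if kl: "k < 8" "l < 8" "k \<noteq> l" for k l
  proof (cases "even k = even l")
    case True
    have "\<not> inc geom (c k) (c l)"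
    proof
      assume "inc geom (c k) (c l)"
      moreover have "c k \<in> elems geom" "c l \<in> elems geom"
        using c_el by (auto simp: h(2) residue_def)
      ultimately have "c k = c l" using True by (intro geom_same_type) (auto simp: c_def ty_def)
      then show False using c_eq kl by simp
    qed
    moreover have "l \<noteq> Suc k mod 8" "k \<noteq> Suc l mod 8" using True par8 even_Suc by metis+
    ultimately show ?thesis by simp
  next
    case False
    then have t: "ty l = st k" "st l = ty k" by (auto simp: ty_def st_def)
    have "inc geom (c k) (c l) \<longleftrightarrow> (\<exists>x \<in> {?d k, ?d (Suc k)}. x \<in> {?d l, ?d (Suc l)})"
      unfolding c_def t(1) d_Suc t(2)
      using ty_st[of k] dP by (intro inc_in_residue_iff[OF h(1)]) auto
    also have "\<dots> \<longleftrightarrow> k mod 8 = l mod 8 \<or> k mod 8 = Suc l mod 8 \<or> Suc k mod 8 = l mod 8 \<or> Suc k mod 8 = Suc l mod 8"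
      proof -
      have *: "(\<exists>x \<in> {p, q}. x \<in> {r, t}) \<longleftrightarrow> p = r \<or> p = t \<or> q = r \<or> q = t" for p q r t :: 'a
        by blast
      show ?thesis unfolding * d_eq by simp
    qed
    also have "\<dots> \<longleftrightarrow> l = Suc k mod 8 \<or> k = Suc l mod 8"
    proof -
      have "k mod 8 = k" "l mod 8 = l" using kl by auto
      moreover have "Suc k mod 8 \<noteq> Suc l mod 8" using kl by (simp add: mod_Suc)
      ultimately show ?thesis using kl(3) by metis
    qed
    finally show ?thesis .
  qed
  have "bij_betw c {..<8} (elems \<Delta>)"
  proof (rule bij_betw_imageI)
    show "inj_on c {..<8}" using c_eq by (auto simp: inj_on_def)
    have "y \<in> c ` {..<8}" if "y \<in> elems \<Delta>" for y
    proof -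
      from that obtain l g where "y = vert l (h \<otimes> g)" "l \<in> {i, j}" "g \<in> P {i, j}" unfolding el by blast
      then obtain m where y: "y = vert l (h \<otimes> ?d m)" "l \<in> {i, j}" using all_d by blast
      have "\<exists>k. y = c k"
      proof (cases "l = ty m")
        case True
        then have "y = c m" using y(1) by (simp add: c_def)
        then show ?thesis ..
      next
        case False
        then have l: "l = ty (m + 7)" using y(2) by (auto simp: ty_def)
        have "?d m = ?d (m + 7) \<otimes> s (st (m + 7))"
          unfolding d_Suc[symmetric] using d_period[of m] m78 by metis
        then have "c (m + 7) = y" using same_ty[of "m + 7" "m + 7" m] unfolding y(1) c_def l by blast
        then show ?thesis by blast
      qed
      then obtain k where "y = c k" by blast
      then have "y = c (k mod 8)" using c_eq[of k "k mod 8"] by simp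
      then show ?thesis by simp
    qed
    then show "c ` {..<8} = elems \<Delta>" using c_el by blast
  qed
  then show "cycle_incidence_graph \<Delta> 8"
    unfolding cycle_incidence_graph_def h(2) residue_simps using c_inc by blast
  have "\<not> inc geom (c 1) (c 4)" using c_inc[of 1 4] by simp
  moreover have "fst (c 1) = i" "fst (c 4) = j" by (simp_all add: c_def ty_def)
  ultimately show "\<not> generalized_digon \<Delta> i j"
    using c_el[of 1] c_el[of 4] unfolding generalized_digon_def
    by (auto simp: h(2) residue_simps geom_simps(2))
qed

end

section \<open>Unitriangular matrices over the field with two elements\<close>

abbreviation elem_mat :: "nat \<Rightarrow> nat \<Rightarrow> nat \<Rightarrow> bit mat" where
  "elem_mat n r c \<equiv> addrow_mat n 1 r c"



lemma index_elem_mat_mult: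
  assumes "A \<in> carrier_mat n n" "c < n" "i < n" "k < n"
  shows "(elem_mat n r c * A) $$ (i, k) = (if i = r then A $$ (c, k) + A $$ (r, k) else A $$ (i, k))"
  using assms addrow_mat[OF assms(1,2), of 1 r, symmetric] by auto

lemma elem_mat_cancel:
  assumes "A \<in> carrier_mat n n" "r \<noteq> c" "c < n"
  shows "elem_mat n r c * (elem_mat n r c * A) = A"
proof -
  have *: "elem_mat n r c * A \<in> carrier_mat n n" using assms(1) by (meson addrow_mat_carrier mult_carrier_mat)
  show ?thesis
    using assms * by (intro eq_matI) (auto simp: index_elem_mat_mult[OF *] index_elem_mat_mult[OF assms(1)]
        simp flip: xor.assoc simp del: index_mult_mat(1))
qed

text \<open>
  For a strict partial order \<open>R\<close> these are the unipotent elements of its incidence algebra. The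
  unitriangular group and its parabolic subgroups are of this form, so that they can be treated
  together.
\<close>

definition unipotent :: "nat \<Rightarrow> (nat \<Rightarrow> nat \<Rightarrow> bool) \<Rightarrow> bit mat set" where
  "unipotent n R = {A \<in> carrier_mat n n. (\<forall>r < n. A $$ (r, r) = 1) \<and>
     (\<forall>r < n. \<forall>c < n. r \<noteq> c \<longrightarrow> A $$ (r, c) = 1 \<longrightarrow> R r c)}"

lemma unipotent_entry: "A \<in> unipotent n R \<Longrightarrow> r < n \<Longrightarrow> k < n \<Longrightarrow> A $$ (r, k) = 0 \<or> r = k \<or> R r k"
  by (cases "A $$ (r, k)") (auto simp: unipotent_def)

lemma carrier_UT: "carrier (UT n) = unipotent n (<)"
proof -
  have "upper_triangular A \<longleftrightarrow> (\<forall>r < n. \<forall>c < n. r \<noteq> c \<longrightarrow> A $$ (r, c) = 1 \<longrightarrow> r < c)"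
    if "A \<in> carrier_mat n n" for A :: "bit mat"
  proof -
    have "A $$ (r, c) = 1 \<longleftrightarrow> A $$ (r, c) \<noteq> 0" for r c by simp
    then show ?thesis
      using that unfolding upper_triangular_def by (metis carrier_matD(1) less_trans nat_neq_iff)
  qed
  then show ?thesis unfolding UT_def unipotent_def partial_object.simps by blast
qed

lemma one_unipotent: "1\<^sub>m n \<in> unipotent n R"
  by (auto simp: unipotent_def)

lemma unipotent_Int: "unipotent n R \<inter> unipotent n R' \<subseteq> unipotent n (\<lambda>r c. R r c \<and> R' r c)"
  by (auto simp: unipotent_def)

text \<open>
  A nonzero term in an entry of the product is a path of at most two steps in \<open>R\<close>. On the diagonal
  such a path can only be the constant one, by irreflexivity.
\<close>

lemma mult_unipotent:
  assumes trans: "\<And>x y z. R x y \<Longrightarrow> R y z \<Longrightarrow> R x z" and irrefl: "\<And>x. \<not> R x x"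
    and A: "A \<in> unipotent n R" and B: "B \<in> unipotent n R"
  shows "A * B \<in> unipotent n R"
proof -
  have c: "A \<in> carrier_mat n n" "B \<in> carrier_mat n n" using A B by (auto simp: unipotent_def)
  have AR: "A $$ (r, k) = 0 \<or> r = k \<or> R r k" "B $$ (r, k) = 0 \<or> r = k \<or> R r k" if "r < n" "k < n" for r k
    using unipotent_entry A B that by blast+
  have entry: "(A * B) $$ (r, k) = (\<Sum>m = 0..<n. A $$ (r, m) * B $$ (m, k))" if "r < n" "k < n" for r k
    using that c by (auto simp: scalar_prod_def intro!: sum.cong)
  have "(A * B) $$ (r, r) = 1" if r: "r < n" for r
  proof -
    have "A $$ (r, m) * B $$ (m, r) = (if m = r then 1 else 0)" if "m \<in> {0..<n}" for m
      proof (cases "m = r")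
      case True
      then show ?thesis using A B r by (simp add: unipotent_def)
    next
      case False
      then have "\<not> (R r m \<and> R m r)" using trans irrefl by blast
      then have "A $$ (r, m) = 0 \<or> B $$ (m, r) = 0" using AR(1)[of r m] AR(2)[of m r] that r False by auto
      then show ?thesis using False by auto
    qed
    then have "(\<Sum>m = 0..<n. A $$ (r, m) * B $$ (m, r)) = (\<Sum>m = 0..<n. if m = r then 1 else 0)"
      by (intro sum.cong) auto
    then show ?thesis using entry r by simp
  qed
  moreover have "R r k" if rk: "r < n" "k < n" "r \<noteq> k" "(A * B) $$ (r, k) \<noteq> 0" for r k
  proof -
    obtain m where m: "m < n" "A $$ (r, m) * B $$ (m, k) \<noteq> 0"
      using rk entry[OF rk(1,2)] by (metis (no_types, lifting) atLeastLessThan_iff sum.neutral)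
    then have "A $$ (r, m) \<noteq> 0" "B $$ (m, k) \<noteq> 0" by auto
    then show ?thesis using AR[of r m] AR[of m k] m rk trans by blast
  qed
  ultimately show ?thesis using c by (auto simp: unipotent_def)
qed

lemma elem_mat_unipotent: "r < n \<Longrightarrow> c < n \<Longrightarrow> r \<noteq> c \<Longrightarrow> R r c \<Longrightarrow> elem_mat n r c \<in> unipotent n R"
  by (auto simp: unipotent_def split: if_splits)

text \<open>
  Row reduction: every such matrix is a product of elementary matrices at positions in \<open>R\<close>. An
  off-diagonal entry in the last row that has one can be cleared by a single row operation that
  changes nothing else, since the row that is added is a row of the identity matrix.
\<close>

lemma unipotent_induct [consumes 1, case_names less one step]:
  assumes A: "A \<in> unipotent n R" and lt: "\<And>r c. R r c \<Longrightarrow> r < c"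
    and one: "Q (1\<^sub>m n)"
    and step: "\<And>B r c. r < c \<Longrightarrow> c < n \<Longrightarrow> R r c \<Longrightarrow> B \<in> unipotent n R \<Longrightarrow> Q B \<Longrightarrow> Q (elem_mat n r c * B)"
  shows "Q A"
  using A
proof (induction "card {(r, c). r < n \<and> c < n \<and> r \<noteq> c \<and> A $$ (r, c) = 1}" arbitrary: A rule: less_induct)
  case less
  define off where "off B = {(r, c). r < n \<and> c < n \<and> r \<noteq> c \<and> (B::bit mat) $$ (r, c) = 1}" for B
  have fin: "finite (off B)" for B
    by (rule finite_subset[of _ "{..<n} \<times> {..<n}"]) (auto simp: off_def)
  have A: "A \<in> carrier_mat n n" "\<And>r. r < n \<Longrightarrow> A $$ (r, r) = 1"
    "\<And>r c. r < n \<Longrightarrow> c < n \<Longrightarrow> r \<noteq> c \<Longrightarrow> A $$ (r, c) = 1 \<Longrightarrow> R r c"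
    using less.prems by (auto simp: unipotent_def)
  show ?case
  proof (cases "off A = {}")
    case True
    then have "A = 1\<^sub>m n" using A by (intro eq_matI) (auto simp: off_def)
    then show ?thesis using one by simp
  next
    case False
    define r where "r = Max (fst ` off A)"
    have "r \<in> fst ` off A" unfolding r_def using False fin by (intro Max_in) auto
    then obtain c where rc: "(r, c) \<in> off A" by auto
    then have rc': "r < n" "c < n" "r \<noteq> c" "A $$ (r, c) = 1" "R r c" using A by (auto simp: off_def)
    have max: "i \<le> r" if "(i, k) \<in> off A" for i k
      unfolding r_def using that fin by (intro Max_ge) force+
    have row_c: "A $$ (c, k) = (if k = c then 1 else 0)" if "k < n" for k
      proof (cases "k = c")
      case False
      have "A $$ (c, k) \<noteq> 1"
      proof
        assume "A $$ (c, k) = 1"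
        then show False using max[of c k] lt[OF rc'(5)] that rc' False by (auto simp: off_def)
      qed
      then show ?thesis using False by simp
    qed (use A(2) rc' in simp)
    let ?B = "elem_mat n r c * A"
    have B: "?B \<in> carrier_mat n n" using A(1) by (meson addrow_mat_carrier mult_carrier_mat)
    have ent: "?B $$ (i, k) = (if (i, k) = (r, c) then 0 else A $$ (i, k))" if "i < n" "k < n" for i k
      using that rc' row_c by (auto simp: index_elem_mat_mult[OF A(1)] simp del: index_mult_mat(1))
    have "?B \<in> unipotent n R"
      using B ent A rc'(3) unfolding unipotent_def by (auto simp del: index_mult_mat(1) split: if_splits)
    moreover have "off ?B = off A - {(r, c)}"
      using ent by (auto simp: off_def split: if_splits)
    then have "card (off ?B) < card (off A)" using rc fin by (metis card_Diff1_less)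
    ultimately have "Q ?B" using less.hyps unfolding off_def by blast
    then have "Q (elem_mat n r c * ?B)"
      using step \<open>?B \<in> unipotent n R\<close> rc' lt by blast
    then show ?thesis using elem_mat_cancel[OF A(1)] rc' by simp
  qed
qed

lemma UT_simps: "mult (UT n) = (*)" "one (UT n) = 1\<^sub>m n"
  by (simp_all add: UT_def)

lemma unipotent_carrier_mat: "A \<in> unipotent n R \<Longrightarrow> A \<in> carrier_mat n n"
  by (simp add: unipotent_def)

text \<open>
  Left inverses exist because every element is a product of elementary matrices, which are
  involutions.
\<close>

lemma group_UT: "group (UT n)"
proof (rule groupI)
  fix A assume "A \<in> carrier (UT n)"
  then have "A \<in> unipotent n (<)" by (simp add: carrier_UT)
  then have "\<exists>B \<in> unipotent n (<). B * A = 1\<^sub>m n"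
  proof (induction rule: unipotent_induct)
    case one
    then show ?case using one_unipotent by (intro bexI[of _ "1\<^sub>m n"]) auto
  next
    case (step A r c)
    then obtain B where B: "B \<in> unipotent n (<)" "B * A = 1\<^sub>m n" by blast
    have T: "elem_mat n r c \<in> unipotent n (<)" using step by (intro elem_mat_unipotent) auto
    have cm: "A \<in> carrier_mat n n" "B \<in> carrier_mat n n" "elem_mat n r c \<in> carrier_mat n n"
      using step B T by (auto dest: unipotent_carrier_mat)
    have "(B * elem_mat n r c) * (elem_mat n r c * A) = B * (elem_mat n r c * (elem_mat n r c * A))"
      using cm by (meson assoc_mult_mat mult_carrier_mat)
    also have "\<dots> = 1\<^sub>m n" using elem_mat_cancel[OF cm(1)] step B by simp
    finally show ?case using B T mult_unipotent[of "(<)"] by (metis less_trans less_irrefl)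
  qed simp
  then show "\<exists>B \<in> carrier (UT n). B \<otimes>\<^bsub>UT n\<^esub> A = \<one>\<^bsub>UT n\<^esub>"
    by (simp add: carrier_UT UT_simps)
next
  fix A B C assume "A \<in> carrier (UT n)" "B \<in> carrier (UT n)" "C \<in> carrier (UT n)"
  then show "A \<otimes>\<^bsub>UT n\<^esub> B \<otimes>\<^bsub>UT n\<^esub> C = A \<otimes>\<^bsub>UT n\<^esub> (B \<otimes>\<^bsub>UT n\<^esub> C)"
    by (auto simp: UT_def assoc_mult_mat)
next
  fix A B assume "A \<in> carrier (UT n)" "B \<in> carrier (UT n)"
  then show "A \<otimes>\<^bsub>UT n\<^esub> B \<in> carrier (UT n)"
    unfolding carrier_UT UT_simps by (intro mult_unipotent) auto
qed (auto simp: carrier_UT UT_simps one_unipotent dest!: unipotent_carrier_mat)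

lemma transvection_eq: "0 < i \<Longrightarrow> transvection n i = elem_mat n (i - 1) i"
  by (intro eq_matI) (auto simp: transvection_def addrow_mat_def)

text \<open>
  Matrix positions count from 0, so $e_i(1)$ acts between rows \<open>i - 1\<close> and \<open>i\<close>, and the path from
  row \<open>r\<close> to row \<open>c\<close> uses the generators with indices \<open>r + 1\<close> to \<open>c\<close>.
\<close>

definition connected_in :: "nat set \<Rightarrow> nat \<Rightarrow> nat \<Rightarrow> bool" where
  "connected_in J r c \<longleftrightarrow> r < c \<and> {r<..c} \<subseteq> J"

lemma connected_in_trans: "connected_in J x y \<Longrightarrow> connected_in J y z \<Longrightarrow> connected_in J x z"
  unfolding connected_in_def using ivl_disj_un_two(6)[of x y z] by auto

lemma connected_in_Suc: "i \<in> J \<Longrightarrow> 0 < i \<Longrightarrow> connected_in J (i - 1) i"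
  by (cases i) (auto simp: connected_in_def le_Suc_eq)

lemma connected_in_Int: "connected_in (J \<inter> K) = (\<lambda>r c. connected_in J r c \<and> connected_in K r c)"
  by (auto simp: connected_in_def fun_eq_iff)

lemma elem_mat_commutator:
  assumes "r < m" "m < c" "c < n"
  shows "elem_mat n r m * (elem_mat n m c * (elem_mat n r m * elem_mat n m c)) = elem_mat n r c"
proof -
  have cm: "elem_mat n r m * elem_mat n m c \<in> carrier_mat n n"
    "elem_mat n m c * (elem_mat n r m * elem_mat n m c) \<in> carrier_mat n n"
    by (meson addrow_mat_carrier mult_carrier_mat)+
  show ?thesis
    using assms
    by (intro eq_matI) (auto simp: index_elem_mat_mult[OF cm(1)] index_elem_mat_mult[OF cm(2)]
        index_elem_mat_mult[OF addrow_mat_carrier] simp del: index_mult_mat(1))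
qed

lemma transvection_in_UT: "i \<in> {1..n - 1} \<Longrightarrow> transvection n i \<in> carrier (UT n)"
  by (auto simp: transvection_eq carrier_UT intro!: elem_mat_unipotent)

lemma transvection_square:
  assumes "i \<in> {1..n - 1}"
  shows "transvection n i \<otimes>\<^bsub>UT n\<^esub> transvection n i = \<one>\<^bsub>UT n\<^esub>"
  using assms elem_mat_cancel[of "1\<^sub>m n" n "i - 1" i]
  by (auto simp: UT_simps transvection_eq right_mult_one_mat[OF addrow_mat_carrier])

text \<open>
  The elementary matrix at position \<open>(r, c)\<close> is an iterated commutator of the generators between \<open>r\<close>
  and \<open>c\<close>; row reduction then shows that the subgroup contains all matrices with the right
  block pattern.
\<close>

lemma generate_transvections:
  assumes J: "J \<subseteq> {1..n - 1}"
  shows "generate (UT n) (transvection n ` J) = unipotent n (connected_in J)"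
proof
  interpret group "UT n" by (rule group_UT)
  have gen: "transvection n j \<in> unipotent n (connected_in J)" if "j \<in> J" for j
    proof -
    have "j \<in> {1..n - 1}" using that J by blast
    then show ?thesis using that connected_in_Suc[of j J] by (auto simp: transvection_eq intro!: elem_mat_unipotent)
  qed
  show "generate (UT n) (transvection n ` J) \<subseteq> unipotent n (connected_in J)"
  proof
    fix x assume "x \<in> generate (UT n) (transvection n ` J)"
    then show "x \<in> unipotent n (connected_in J)"
    proof (induction rule: generate.induct)
      case one
      then show ?case using one_unipotent by (simp add: UT_simps)
    next
      case (incl h)
      then show ?case using gen by auto
    next
      case (inv h)
      then obtain j where j: "j \<in> J" "h = transvection n j" by blast
      then have "inv\<^bsub>UT n\<^esub> h = h"
        using J by (intro inv_equality) (auto intro!: transvection_in_UT transvection_square)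
      then show ?case using gen j by simp
    next
      case (eng h1 h2)
      then show ?case
        unfolding UT_simps
        by (intro mult_unipotent) (auto intro: connected_in_trans simp: connected_in_def[of J "x" x for x])
    qed
  qed
  have sub: "transvection n ` J \<subseteq> carrier (UT n)" using transvection_in_UT J by blast
  have T: "elem_mat n r c \<in> generate (UT n) (transvection n ` J)" if "connected_in J r c" "c < n" for r c
    using that
  proof (induction c)
    case (Suc c)
    have step: "elem_mat n c (Suc c) \<in> generate (UT n) (transvection n ` J)"
      proof -
      have "transvection n (Suc c) \<in> generate (UT n) (transvection n ` J)"
        using Suc.prems by (intro generate.incl imageI) (auto simp: connected_in_def)
      then show ?thesis by (simp add: transvection_eq)
    qed
    show ?case
    proof (cases "r = c")
      case False
      then have rc: "r < c" "connected_in J r c" using Suc.prems by (auto simp: connected_in_def)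
      then have "elem_mat n r c \<in> generate (UT n) (transvection n ` J)" using Suc by simp
      then show ?thesis
        using step elem_mat_commutator[of r c "Suc c" n] rc Suc.prems(2) generate.eng[of _ "UT n", unfolded UT_simps]
        by (metis lessI)
    qed (use step in simp)
  qed (simp add: connected_in_def)
  show "unipotent n (connected_in J) \<subseteq> generate (UT n) (transvection n ` J)"
  proof
    fix A assume "A \<in> unipotent n (connected_in J)"
    then show "A \<in> generate (UT n) (transvection n ` J)"
    proof (induction rule: unipotent_induct)
      case one
      then show ?case using generate.one[of "UT n"] by (simp add: UT_simps)
    next
      case (step B r c)
      then show ?case using T generate.eng[of _ "UT n"] unfolding UT_simps by blast
    qed (simp add: connected_in_def)
  qed
qed

lemma UT_word_simps:
  assumes "i \<in> {1..n - 1}" "A \<in> carrier_mat n n"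
  shows "transvection n i * A \<in> carrier_mat n n"
    "\<lbrakk>r < n; c < n\<rbrakk> \<Longrightarrow> (transvection n i * A) $$ (r, c) = (if Suc r = i then A $$ (i, c) + A $$ (r, c) else A $$ (r, c))"
proof -
  have e: "transvection n i = elem_mat n (i - 1) i" "i < n" "Suc r = i \<longleftrightarrow> r = i - 1" for r
    using assms transvection_eq by auto
  show "transvection n i * A \<in> carrier_mat n n"
    using assms e by (metis addrow_mat_carrier mult_carrier_mat)
  show "\<lbrakk>r < n; c < n\<rbrakk> \<Longrightarrow> (transvection n i * A) $$ (r, c) = (if Suc r = i then A $$ (i, c) + A $$ (r, c) else A $$ (r, c))"
    using index_elem_mat_mult[OF assms(2) e(2), of r c "i - 1"] unfolding e by simp
qed

lemma transvection_carrier [simp]: "transvection n i \<in> carrier_mat n n"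
  "dim_row (transvection n i) = n" "dim_col (transvection n i) = n"
  by (simp_all add: transvection_def)

lemma transvection_commute:
  assumes "i \<in> {1..n - 1}" "j \<in> {1..n - 1}" "Suc i < j"
  shows "transvection n i * transvection n j = transvection n j * transvection n i"
proof (rule eq_matI)
  fix r c assume "r < dim_row (transvection n j * transvection n i)" "c < dim_col (transvection n j * transvection n i)"
  then have "r < n" "c < n" by auto
  then show "(transvection n i * transvection n j) $$ (r, c) = (transvection n j * transvection n i) $$ (r, c)"
    using assms UT_word_simps(2)[OF assms(1) transvection_carrier(1), of r c j]
      UT_word_simps(2)[OF assms(2) transvection_carrier(1), of r c i]
    by (auto simp: transvection_def simp del: index_mult_mat(1))
qed auto

lemma bit_add_cancel: "x + x = 0" "x + (x + y) = y" for x y :: bit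
  by (cases x; cases y; simp)+

text \<open>
  The words are evaluated as sequences of row operations; only rows \<open>i - 1\<close> and \<open>i\<close> (counted
  from 0) are affected.
\<close>

lemma transvection_braid:
  fixes n i
  assumes i: "i \<in> {1..n - 2}"
  defines "x \<equiv> transvection n i \<otimes>\<^bsub>UT n\<^esub> transvection n (i + 1)"
  shows "x [^]\<^bsub>UT n\<^esub> (4::nat) = \<one>\<^bsub>UT n\<^esub>" "x [^]\<^bsub>UT n\<^esub> (2::nat) \<noteq> \<one>\<^bsub>UT n\<^esub>"
proof -
  interpret group "UT n" by (rule group_UT)
  define a b where "a = transvection n i" and "b = transvection n (Suc i)"
  have I: "i \<in> {1..n - 1}" "Suc i \<in> {1..n - 1}" using i by auto
  have ab: "a \<in> carrier (UT n)" "b \<in> carrier (UT n)"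
    using I transvection_in_UT by (auto simp: a_def b_def)
  note simps = UT_word_simps[OF I(1), folded a_def] UT_word_simps[OF I(2), folded b_def]
  let ?e = "1\<^sub>m n :: bit mat"
  have two: "x [^]\<^bsub>UT n\<^esub> (2::nat) = a * (b * (a * (b * ?e)))"
    using ab unfolding x_def UT_simps[of n, symmetric]
    by (simp add: numeral_eq_Suc m_assoc a_def[symmetric] b_def[symmetric])
  have "x [^]\<^bsub>UT n\<^esub> (4::nat) = a * (b * (a * (b * (a * (b * (a * (b * ?e)))))))"
    using ab unfolding x_def UT_simps[of n, symmetric]
    by (simp add: numeral_eq_Suc m_assoc a_def[symmetric] b_def[symmetric])
  also have "\<dots> = ?e"
  proof (rule eq_matI)
    fix r k assume "r < dim_row ?e" "k < dim_col ?e"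
    then have rk: "r < n" "k < n" by auto
    note s = simps bit_add_cancel add.assoc add.left_commute add.commute
    consider "Suc r = i" | "r = i" | "Suc r \<noteq> i" "r \<noteq> i" by blast
    then show "(a * (b * (a * (b * (a * (b * (a * (b * ?e)))))))) $$ (r, k) = ?e $$ (r, k)"
    proof cases
      case 1
      then have "i < n" "Suc i < n" using i by auto
      then show ?thesis using rk 1 by (simp add: s del: index_mult_mat(1) index_one_mat(1) add_bit_eq_xor)
    next
      case 2
      then have "Suc i < n" using i by auto
      then show ?thesis using rk 2 by (simp add: s del: index_mult_mat(1) index_one_mat(1) add_bit_eq_xor)
    next
      case 3
      then show ?thesis using rk by (simp add: s del: index_mult_mat(1) index_one_mat(1) add_bit_eq_xor)
    qed
  qed (simp_all add: a_def)
  finally show "x [^]\<^bsub>UT n\<^esub> (4::nat) = \<one>\<^bsub>UT n\<^esub>" by (simp add: UT_simps)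
  have "(x [^]\<^bsub>UT n\<^esub> (2::nat)) $$ (i - 1, i + 1) = 1"
    unfolding two using i by (auto simp: simps simp del: index_mult_mat(1))
  moreover have "?e $$ (i - 1, i + 1) = 0" using i by auto
  ultimately show "x [^]\<^bsub>UT n\<^esub> (2::nat) \<noteq> \<one>\<^bsub>UT n\<^esub>" unfolding UT_simps by (metis zero_neq_one)
qed

lemma transvection_triple:
  fixes n i
  assumes i: "i \<in> {1..n - 3}"
  shows "(transvection n i \<otimes>\<^bsub>UT n\<^esub> transvection n (i + 1) \<otimes>\<^bsub>UT n\<^esub> transvection n (i + 2)) [^]\<^bsub>UT n\<^esub> (4::nat) = \<one>\<^bsub>UT n\<^esub>"
proof -
  interpret group "UT n" by (rule group_UT)
  define a b c where "a = transvection n i" and "b = transvection n (Suc i)" and "c = transvection n (Suc (Suc i))"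
  have I: "i \<in> {1..n - 1}" "Suc i \<in> {1..n - 1}" "Suc (Suc i) \<in> {1..n - 1}" using i by auto
  have ab: "a \<in> carrier (UT n)" "b \<in> carrier (UT n)" "c \<in> carrier (UT n)"
    using I transvection_in_UT by (auto simp: a_def b_def c_def)
  note simps = UT_word_simps[OF I(1), folded a_def] UT_word_simps[OF I(2), folded b_def]
    UT_word_simps[OF I(3), folded c_def]
  let ?e = "1\<^sub>m n :: bit mat"
  have "(a \<otimes>\<^bsub>UT n\<^esub> b \<otimes>\<^bsub>UT n\<^esub> c) [^]\<^bsub>UT n\<^esub> (4::nat)
    = a * (b * (c * (a * (b * (c * (a * (b * (c * (a * (b * (c * ?e)))))))))))"
    using ab unfolding UT_simps[of n, symmetric] by (simp add: numeral_eq_Suc m_assoc)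
  also have "\<dots> = ?e"
  proof (rule eq_matI)
    fix r k assume "r < dim_row ?e" "k < dim_col ?e"
    then have rk: "r < n" "k < n" by auto
    note s = simps bit_add_cancel add.assoc add.left_commute add.commute
    consider "Suc r = i" | "r = i" | "r = Suc i" | "Suc r \<noteq> i" "r \<noteq> i" "r \<noteq> Suc i" by blast
    then show "(a * (b * (c * (a * (b * (c * (a * (b * (c * (a * (b * (c * ?e)))))))))))) $$ (r, k) = ?e $$ (r, k)"
    proof cases
      case 1
      then have "i < n" "Suc i < n" "Suc (Suc i) < n" using i by auto
      then show ?thesis using rk 1 by (simp add: s del: index_mult_mat(1) index_one_mat(1) add_bit_eq_xor)
    next
      case 2
      then have "Suc i < n" "Suc (Suc i) < n" using i by auto
      then show ?thesis using rk 2 by (simp add: s del: index_mult_mat(1) index_one_mat(1) add_bit_eq_xor)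
    next
      case 3
      then have "Suc (Suc i) < n" using i by auto
      then show ?thesis using rk 3 by (simp add: s del: index_mult_mat(1) index_one_mat(1) add_bit_eq_xor)
    next
      case 4
      then show ?thesis using rk by (simp add: s del: index_mult_mat(1) index_one_mat(1) add_bit_eq_xor)
    qed
  qed (simp_all add: a_def)
  finally show ?thesis by (simp add: UT_simps a_def b_def c_def)
qed

section \<open>Iterated commutators of involutions\<close>

context group
begin

abbreviation commuting :: "'a \<Rightarrow> 'a \<Rightarrow> bool" where
  "commuting x y \<equiv> x \<otimes> y = y \<otimes> x"

lemma commuting_mult:
  assumes "x \<in> carrier G" "y \<in> carrier G" "z \<in> carrier G" "commuting x y" "commuting x z"
  shows "commuting x (y \<otimes> z)"
  using assms by (metis m_assoc)

lemma involution_cancel: "a \<in> carrier G \<Longrightarrow> a \<otimes> a = \<one> \<Longrightarrow> x \<in> carrier G \<Longrightarrow> a \<otimes> (a \<otimes> x) = x"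
  by (simp add: m_assoc[symmetric])

lemma commuting_conj:
  assumes "a \<in> carrier G" "a \<otimes> a = \<one>" "x \<in> carrier G"
  shows "commuting a x \<longleftrightarrow> a \<otimes> x \<otimes> a = x"
  using assms by (metis m_assoc m_closed r_one involution_cancel)

lemma commuting_swap:
  assumes "c \<in> carrier G" "a \<in> carrier G" "x \<in> carrier G" "commuting a c"
  shows "c \<otimes> (a \<otimes> x) = a \<otimes> (c \<otimes> x)"
  using assms by (metis m_assoc)

lemma pass_through:
  assumes "a \<in> carrier G" "u \<in> carrier G" "v \<in> carrier G" "y \<in> carrier G"
    and "a \<otimes> u = v \<otimes> a" "commuting a y"
  shows "a \<otimes> (u \<otimes> y) = v \<otimes> y \<otimes> a"
proof -
  have "a \<otimes> (u \<otimes> y) = v \<otimes> (a \<otimes> y)" using assms(1-5) by (simp flip: m_assoc)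
  then show ?thesis using assms by (simp add: m_assoc)
qed

lemma commutator_involution:
  assumes ab: "a \<in> carrier G" "b \<in> carrier G" "a \<otimes> a = \<one>" "b \<otimes> b = \<one>" and "(a \<otimes> b) [^] (4::nat) = \<one>"
  defines "u \<equiv> a \<otimes> b \<otimes> a \<otimes> b"
  shows "u \<otimes> u = \<one>" "commuting a u" "commuting b u" "u = b \<otimes> a \<otimes> b \<otimes> a"
proof -
  note canc = involution_cancel[OF ab(1,3)] involution_cancel[OF ab(2,4)]
  have "(a \<otimes> b) [^] (4::nat) = u \<otimes> u" using ab by (simp add: numeral_eq_Suc m_assoc u_def)
  then show uu: "u \<otimes> u = \<one>" using assms by simp
  have "u \<otimes> (b \<otimes> a \<otimes> b \<otimes> a) = \<one>" using ab by (simp add: m_assoc u_def canc)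
  then have "u \<otimes> (b \<otimes> a \<otimes> b \<otimes> a) = u \<otimes> u" using uu by simp
  then show sw: "u = b \<otimes> a \<otimes> b \<otimes> a" using ab by (simp add: u_def)
  have "u \<otimes> a = (b \<otimes> a \<otimes> b \<otimes> a) \<otimes> a" using sw by simp
  also have "\<dots> = b \<otimes> a \<otimes> b" using ab by (simp add: m_assoc)
  also have "\<dots> = a \<otimes> u" using ab by (simp add: u_def m_assoc canc)
  finally show "commuting a u" by simp
  have "b \<otimes> u = b \<otimes> (b \<otimes> a \<otimes> b \<otimes> a)" using sw by simp
  also have "\<dots> = u \<otimes> b" using ab by (simp add: u_def m_assoc canc)
  finally show "commuting b u" .
qed

text \<open>
  For commuting involutions \<open>a\<close> and \<open>c\<close>, the iterated commutators $[a, [b, c]]$ and $[[a, b], c]$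
  are conjugate under \<open>b \<otimes> a\<close>. Here \<open>f\<close> and \<open>g\<close> are the commutators $[b, c]$ and $[a, b]$, which
  for involutions are the squares of \<open>b \<otimes> c\<close> and \<open>a \<otimes> b\<close>.
\<close>

lemma iterated_commutators_conjugate:
  assumes abc: "a \<in> carrier G" "b \<in> carrier G" "c \<in> carrier G"
    "a \<otimes> a = \<one>" "b \<otimes> b = \<one>" "c \<otimes> c = \<one>" "commuting a c"
  defines "f \<equiv> b \<otimes> c \<otimes> b \<otimes> c" and "g \<equiv> a \<otimes> b \<otimes> a \<otimes> b"
  assumes f: "f \<otimes> f = \<one>" and g: "g \<otimes> g = \<one>"
  shows "a \<otimes> f \<otimes> a \<otimes> f = (a \<otimes> b \<otimes> c \<otimes> b) \<otimes> (a \<otimes> b \<otimes> c \<otimes> b)"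
    "b \<otimes> (a \<otimes> f \<otimes> a \<otimes> f) \<otimes> b = a \<otimes> (g \<otimes> c \<otimes> g \<otimes> c) \<otimes> a"
    "a \<otimes> (g \<otimes> c \<otimes> g \<otimes> c) \<otimes> a = (b \<otimes> a \<otimes> b \<otimes> c) \<otimes> (b \<otimes> a \<otimes> b \<otimes> c)"
proof -
  note rules = m_assoc involution_cancel[OF abc(1,4)] involution_cancel[OF abc(2,5)]
    involution_cancel[OF abc(3,6)] abc(1-6) commuting_swap[OF abc(3,1) _ abc(7)] abc(7)[symmetric]
  have fg: "f \<in> carrier G" "g \<in> carrier G" using abc by (auto simp: f_def g_def)
  have "f \<otimes> (c \<otimes> b \<otimes> c \<otimes> b) = \<one>" using abc by (simp add: rules f_def)
  then have "f \<otimes> (c \<otimes> b \<otimes> c \<otimes> b) = f \<otimes> f" using f by simp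
  then have f': "f = c \<otimes> b \<otimes> c \<otimes> b" using fg abc(1-3) by simp
  have "g \<otimes> (b \<otimes> a \<otimes> b \<otimes> a) = \<one>" using abc by (simp add: rules g_def)
  then have "g \<otimes> (b \<otimes> a \<otimes> b \<otimes> a) = g \<otimes> g" using g by simp
  then have g': "g = b \<otimes> a \<otimes> b \<otimes> a" using fg abc(1-3) by simp
  have "a \<otimes> f \<otimes> a \<otimes> f = a \<otimes> (b \<otimes> c \<otimes> b \<otimes> c) \<otimes> a \<otimes> (c \<otimes> b \<otimes> c \<otimes> b)"
    using f' f_def by simp
  also have "\<dots> = (a \<otimes> b \<otimes> c \<otimes> b) \<otimes> (a \<otimes> b \<otimes> c \<otimes> b)" by (simp add: rules)
  finally show 1: "a \<otimes> f \<otimes> a \<otimes> f = (a \<otimes> b \<otimes> c \<otimes> b) \<otimes> (a \<otimes> b \<otimes> c \<otimes> b)" .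
  have "a \<otimes> (g \<otimes> c \<otimes> g \<otimes> c) \<otimes> a = a \<otimes> ((a \<otimes> b \<otimes> a \<otimes> b) \<otimes> c \<otimes> (b \<otimes> a \<otimes> b \<otimes> a) \<otimes> c) \<otimes> a"
    using g' g_def by simp
  also have "\<dots> = (b \<otimes> a \<otimes> b \<otimes> c) \<otimes> (b \<otimes> a \<otimes> b \<otimes> c)" by (simp add: rules)
  finally show 2: "a \<otimes> (g \<otimes> c \<otimes> g \<otimes> c) \<otimes> a = (b \<otimes> a \<otimes> b \<otimes> c) \<otimes> (b \<otimes> a \<otimes> b \<otimes> c)" .
  show "b \<otimes> (a \<otimes> f \<otimes> a \<otimes> f) \<otimes> b = a \<otimes> (g \<otimes> c \<otimes> g \<otimes> c) \<otimes> a"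
    unfolding 1 2 by (simp add: rules)
qed

text \<open>
  In the group $[4,4]$ the elements \<open>x\<close> and \<open>y\<close> of the proof are commuting translations of the
  square tessellation, and $(abc)^2$ is their product. Conjugation by \<open>a\<close> fixes \<open>x\<close> and inverts \<open>y\<close>.
  Therefore $(abc)^4 = 1$ yields both $x^2 y^2 = 1$ and $x^2 y^{-2} = 1$. So $x^2 = y^2$ has square
  one, and it equals both iterated commutators. It is invariant under the generators because \<open>a\<close>
  fixes \<open>x\<close>, \<open>c\<close> fixes \<open>y\<close>, and \<open>b\<close> interchanges \<open>x\<close> and \<open>y\<close>.
\<close>

lemma three_generator_commutator:
  assumes abc: "a \<in> carrier G" "b \<in> carrier G" "c \<in> carrier G"
    "a \<otimes> a = \<one>" "b \<otimes> b = \<one>" "c \<otimes> c = \<one>" "commuting a c"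
    and ab: "(a \<otimes> b) [^] (4::nat) = \<one>" and bc: "(b \<otimes> c) [^] (4::nat) = \<one>"
    and four: "(a \<otimes> b \<otimes> c) [^] (4::nat) = \<one>"
  defines "f \<equiv> b \<otimes> c \<otimes> b \<otimes> c" and "g \<equiv> a \<otimes> b \<otimes> a \<otimes> b"
  defines "w \<equiv> a \<otimes> f \<otimes> a \<otimes> f"
  shows "w \<otimes> w = \<one>" "commuting a w" "commuting b w" "commuting c w" "w = g \<otimes> c \<otimes> g \<otimes> c"
proof -
  note rules = m_assoc involution_cancel[OF abc(1,4)] involution_cancel[OF abc(2,5)]
    involution_cancel[OF abc(3,6)] abc(1-6) commuting_swap[OF abc(3,1) _ abc(7)] abc(7)[symmetric]
  note f = commutator_involution[OF abc(2,3,5,6) bc, folded f_def]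
  note g = commutator_involution[OF abc(1,2,4,5) ab, folded g_def]
  note conj = iterated_commutators_conjugate[OF abc, folded f_def g_def, OF f(1) g(1)]
  have fg: "f \<in> carrier G" "g \<in> carrier G" using abc by (auto simp: f_def g_def)
  define x y t where "x = b \<otimes> a \<otimes> b \<otimes> c" and "y = a \<otimes> b \<otimes> c \<otimes> b" and "t = a \<otimes> b \<otimes> c \<otimes> a \<otimes> b \<otimes> c"
  have c: "x \<in> carrier G" "y \<in> carrier G" "t \<in> carrier G" "w \<in> carrier G"
    using abc fg by (auto simp: x_def y_def t_def w_def)
  have w: "w = y \<otimes> y" using conj(1) by (simp add: w_def y_def)
  have w2: "a \<otimes> (g \<otimes> c \<otimes> g \<otimes> c) \<otimes> a = x \<otimes> x" using conj(3) by (simp add: x_def)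
  have bwb: "b \<otimes> w \<otimes> b = x \<otimes> x" using conj(2) w2 by (simp add: w_def)
  have tt: "t \<otimes> t = \<one>" using four abc by (simp add: t_def numeral_eq_Suc m_assoc)
  have yx: "y \<otimes> x = t" by (simp add: x_def y_def t_def rules)
  have xy: "x \<otimes> y = t"
  proof -
    have "x \<otimes> y = (b \<otimes> a \<otimes> b \<otimes> a) \<otimes> (c \<otimes> b \<otimes> c \<otimes> b)" by (simp add: x_def y_def rules)
    also have "\<dots> = g \<otimes> f" using f(4) g(4) by simp
    also have "\<dots> = t" by (simp add: f_def g_def t_def rules)
    finally show ?thesis .
  qed
  have xxyy: "(x \<otimes> x) \<otimes> (y \<otimes> y) = \<one>"
  proof -
    have "(x \<otimes> x) \<otimes> (y \<otimes> y) = x \<otimes> (x \<otimes> y) \<otimes> y" using c by (simp add: m_assoc)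
    also have "\<dots> = x \<otimes> (y \<otimes> x) \<otimes> y" using xy yx by simp
    also have "\<dots> = (x \<otimes> y) \<otimes> (x \<otimes> y)" using c by (simp add: m_assoc)
    finally show ?thesis using xy tt by simp
  qed
  have ax: "a \<otimes> x \<otimes> a = x"
  proof -
    have "a \<otimes> x \<otimes> a = g \<otimes> a \<otimes> c" by (simp add: x_def g_def rules)
    also have "\<dots> = (b \<otimes> a \<otimes> b \<otimes> a) \<otimes> a \<otimes> c" using g(4) by simp
    also have "\<dots> = x" by (simp add: x_def rules)
    finally show ?thesis .
  qed
  define z where "z = a \<otimes> y \<otimes> a"
  have z: "z \<in> carrier G" "z \<otimes> y = \<one>"
    using c abc by (simp add: z_def) (simp add: z_def y_def rules)
  have "a \<otimes> ((x \<otimes> x) \<otimes> (y \<otimes> y)) \<otimes> a = (a \<otimes> x \<otimes> a) \<otimes> (a \<otimes> x \<otimes> a) \<otimes> z \<otimes> z"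
    using c by (simp add: rules z_def)
  then have xxzz: "x \<otimes> x \<otimes> z \<otimes> z = \<one>" using xxyy ax abc(1,4) by simp
  have "y \<otimes> y = x \<otimes> x \<otimes> z \<otimes> z \<otimes> (y \<otimes> y)" unfolding xxzz using c by simp
  also have "\<dots> = x \<otimes> x \<otimes> z \<otimes> (z \<otimes> y) \<otimes> y" using c z(1) by (simp add: m_assoc)
  also have "\<dots> = x \<otimes> x \<otimes> (z \<otimes> y)" using c z by (simp add: m_assoc)
  finally have xx: "x \<otimes> x = y \<otimes> y" using z c by simp
  show ww: "w \<otimes> w = \<one>" using xxyy xx w by simp
  have cy: "c \<otimes> y \<otimes> c = y"
  proof -
    have "c \<otimes> y \<otimes> c = a \<otimes> (c \<otimes> b \<otimes> c \<otimes> b) \<otimes> c" by (simp add: y_def rules)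
    also have "\<dots> = a \<otimes> f \<otimes> c" using f(4) by simp
    also have "\<dots> = y" by (simp add: y_def f_def rules)
    finally show ?thesis .
  qed
  have "c \<otimes> w \<otimes> c = (c \<otimes> y \<otimes> c) \<otimes> (c \<otimes> y \<otimes> c)" unfolding w using c by (simp add: rules)
  then show "commuting c w" using commuting_conj[OF abc(3,6)] c cy w by simp
  show "commuting b w" using commuting_conj[OF abc(2,5)] c bwb xx w by simp
  have axx: "a \<otimes> (x \<otimes> x) \<otimes> a = x \<otimes> x"
  proof -
    have "a \<otimes> (x \<otimes> x) \<otimes> a = (a \<otimes> x \<otimes> a) \<otimes> (a \<otimes> x \<otimes> a)" using c by (simp add: rules)
    then show ?thesis using ax by simp
  qed
  then show "commuting a w" using commuting_conj[OF abc(1,4)] c xx w by simp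
  have "g \<otimes> c \<otimes> g \<otimes> c = a \<otimes> (a \<otimes> (g \<otimes> c \<otimes> g \<otimes> c) \<otimes> a) \<otimes> a" using fg by (simp add: rules)
  then show "w = g \<otimes> c \<otimes> g \<otimes> c" using w2 axx xx w by simp
qed

end

section \<open>The relations of the unitriangular group\<close>

locale UT_relations = group G for G (structure) +
  fixes n :: nat and s :: "nat \<Rightarrow> 'a"
  assumes s_closed: "i \<in> {1..n - 1} \<Longrightarrow> s i \<in> carrier G"
    and s_square: "i \<in> {1..n - 1} \<Longrightarrow> s i \<otimes> s i = \<one>"
    and s_commute: "i \<in> {1..n - 1} \<Longrightarrow> j \<in> {1..n - 1} \<Longrightarrow> Suc i < j \<Longrightarrow> s i \<otimes> s j = s j \<otimes> s i"
    and s_braid: "i \<in> {1..n - 2} \<Longrightarrow> (s i \<otimes> s (i + 1)) [^] (4::nat) = \<one>"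
    and s_triple: "i \<in> {1..n - 3} \<Longrightarrow> (s i \<otimes> s (i + 1) \<otimes> s (i + 2)) [^] (4::nat) = \<one>"
begin

text \<open>
  \<open>root i k\<close> is the iterated commutator of $s_i, \dots, s_{i+k}$. In the unitriangular group it is
  the elementary matrix at position \<open>(i - 1, i + k)\<close>, a root element.
\<close>

fun root :: "nat \<Rightarrow> nat \<Rightarrow> 'a" where
  "root i 0 = s i"
| "root i (Suc k) = s i \<otimes> root (Suc i) k \<otimes> s i \<otimes> root (Suc i) k"

lemma root_closed: "0 < i \<Longrightarrow> i + k < n \<Longrightarrow> root i k \<in> carrier G"
  by (induction k arbitrary: i) (auto intro!: s_closed m_closed)

lemma commuting_root:
  assumes "0 < i" "i + k < n" "x \<in> carrier G" "\<And>j. i \<le> j \<Longrightarrow> j \<le> i + k \<Longrightarrow> commuting x (s j)"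
  shows "commuting x (root i k)"
  using assms
proof (induction k arbitrary: i)
  case (Suc k)
  have c: "s i \<in> carrier G" "root (Suc i) k \<in> carrier G"
    using Suc.prems root_closed[of "Suc i" k] s_closed[of i] by auto
  have "commuting x (s i)" "commuting x (root (Suc i) k)" using Suc by auto
  then show ?case using c Suc.prems(3) by (simp add: commuting_mult)
qed simp

lemma s_commute': "i \<in> {1..n - 1} \<Longrightarrow> j \<in> {1..n - 1} \<Longrightarrow> Suc i < j \<or> Suc j < i \<Longrightarrow> commuting (s i) (s j)"
  using s_commute by metis

text \<open>
  Strong induction on \<open>k\<close>. The braid relation is the case \<open>k = 1\<close>, and
  \<open>three_generator_commutator\<close> is the case \<open>k = 2\<close>.

  For \<open>k \<ge> 3\<close> put \<open>a = s i\<close>, \<open>c = s (i + k)\<close> and let \<open>b\<close> be the commutator of the generators in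
  between. There are two candidates, $w = [a, [b, c]]$ and $w' = [[a, b], c]$. By induction \<open>w\<close>
  commutes with all generators from \<open>i + 2\<close> on and \<open>w'\<close> with all up to \<open>i + k - 2\<close>; in particular
  \<open>w'\<close> commutes with \<open>a\<close>, so that \<open>w'\<close> is the conjugate of \<open>w\<close> by \<open>b\<close>. The generator with index
  \<open>i + 1\<close> commutes with \<open>b\<close> and with \<open>w'\<close>, hence also with \<open>w\<close>. Then \<open>w\<close> commutes with all the
  generators that occur in \<open>b\<close>, hence with \<open>b\<close>, and \<open>w = w'\<close>. Finally \<open>a\<close> both inverts and
  centralizes \<open>w\<close>.
\<close>

lemma root_central:
  assumes "0 < i" "i + k < n"
  shows "root i k \<otimes> root i k = \<one> \<and> (\<forall>j. i \<le> j \<and> j \<le> i + k \<longrightarrow> commuting (s j) (root i k)) \<and>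
    (\<forall>l. k = Suc l \<longrightarrow> root i k = root i l \<otimes> s (i + k) \<otimes> root i l \<otimes> s (i + k))"
  using assms
proof (induction k arbitrary: i rule: less_induct)
  case (less k)
  consider "k = 0" | "k = 1" | "k = 2" | l where "k = Suc (Suc (Suc l))"
    by (metis One_nat_def Suc_1 not0_implies_Suc)
  then show ?case
  proof cases
    case 1
    then show ?thesis using less.prems s_square by auto
  next
    case 2
    then have I: "i \<in> {1..n - 1}" "Suc i \<in> {1..n - 1}" "i \<in> {1..n - 2}" using less.prems by auto
    note * = commutator_involution[OF s_closed[OF I(1)] s_closed[OF I(2)] s_square[OF I(1)] s_square[OF I(2)]]
    have "(s i \<otimes> s (Suc i)) [^] (4::nat) = \<one>" using s_braid[OF I(3)] by simp
    from *[OF this] 2 show ?thesis by (auto simp: le_Suc_eq numeral_eq_Suc)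
  next
    case 3
    then have I: "i \<in> {1..n - 1}" "Suc i \<in> {1..n - 1}" "Suc (Suc i) \<in> {1..n - 1}"
      "i \<in> {1..n - 2}" "Suc i \<in> {1..n - 2}" "i \<in> {1..n - 3}" using less.prems by auto
    have rel: "(s i \<otimes> s (Suc i)) [^] (4::nat) = \<one>" "(s (Suc i) \<otimes> s (Suc (Suc i))) [^] (4::nat) = \<one>"
      "(s i \<otimes> s (Suc i) \<otimes> s (Suc (Suc i))) [^] (4::nat) = \<one>" "commuting (s i) (s (Suc (Suc i)))"
      using s_braid[OF I(4)] s_braid[OF I(5)] s_triple[OF I(6)] s_commute[OF I(1,3)] by auto
    have *: "root i k = s i \<otimes> (s (Suc i) \<otimes> s (Suc (Suc i)) \<otimes> s (Suc i) \<otimes> s (Suc (Suc i))) \<otimes> s i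
      \<otimes> (s (Suc i) \<otimes> s (Suc (Suc i)) \<otimes> s (Suc i) \<otimes> s (Suc (Suc i)))"
      "root i (Suc 0) = s i \<otimes> s (Suc i) \<otimes> s i \<otimes> s (Suc i)"
      using 3 by (simp_all add: numeral_2_eq_2)
    note T = three_generator_commutator[OF s_closed[OF I(1)] s_closed[OF I(2)] s_closed[OF I(3)]
      s_square[OF I(1)] s_square[OF I(2)] s_square[OF I(3)] rel(4) rel(1-3), folded *]
    have "commuting (s j) (root i k)" if "i \<le> j" "j \<le> i + k" for j
      using T(2-4) that 3 by (auto simp: le_Suc_eq numeral_2_eq_2)
    then show ?thesis using T(1,5) 3 by (auto simp: numeral_2_eq_2)
  next
    case (4 l)
    define a b c where "a = s i" and "b = root (Suc i) (Suc l)" and "c = s (i + k)"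
    define f g where "f = root (Suc i) (Suc (Suc l))" and "g = root i (Suc (Suc l))"
    define w w' where "w = a \<otimes> f \<otimes> a \<otimes> f" and "w' = g \<otimes> c \<otimes> g \<otimes> c"
    have bounds: "0 < i" "i + k < n" using less.prems by auto
    have C: "a \<in> carrier G" "b \<in> carrier G" "c \<in> carrier G" "f \<in> carrier G" "g \<in> carrier G"
      unfolding a_def b_def c_def f_def g_def using bounds 4 by (auto intro!: s_closed root_closed simp del: root.simps)
    have wC: "w \<in> carrier G" "w' \<in> carrier G" using C by (auto simp: w_def w'_def)
    have B: "b \<otimes> b = \<one>" "\<And>j. Suc i \<le> j \<Longrightarrow> j \<le> i + Suc (Suc l) \<Longrightarrow> commuting (s j) b"
      using less.IH[of "Suc l" "Suc i"] bounds 4 unfolding b_def by auto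
    have F: "f \<otimes> f = \<one>" "\<And>j. Suc i \<le> j \<Longrightarrow> j \<le> i + k \<Longrightarrow> commuting (s j) f"
        "f = b \<otimes> c \<otimes> b \<otimes> c"
      using less.IH[of "Suc (Suc l)" "Suc i"] bounds 4 unfolding f_def b_def c_def by (auto simp del: root.simps)
    have Gg: "g \<otimes> g = \<one>" "\<And>j. i \<le> j \<Longrightarrow> j \<le> i + Suc (Suc l) \<Longrightarrow> commuting (s j) g"
      using less.IH[of "Suc (Suc l)" i] bounds 4 unfolding g_def by (auto simp del: root.simps)
    have g': "g = a \<otimes> b \<otimes> a \<otimes> b" by (simp add: g_def a_def b_def)
    have sq: "a \<otimes> a = \<one>" "c \<otimes> c = \<one>" using s_square bounds by (auto simp: a_def c_def)
    have ac: "commuting a c" using s_commute[of i "i + k"] bounds 4 by (auto simp: a_def c_def)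
    have conj: "b \<otimes> w \<otimes> b = a \<otimes> w' \<otimes> a"
      using iterated_commutators_conjugate(2)[OF C(1,2,3) sq(1) B(1) sq(2) ac] F(1,3) Gg(1) g'
      unfolding w_def w'_def by simp
    have w_com: "commuting (s j) w" if "Suc (Suc i) \<le> j" "j \<le> i + k" for j
    proof -
      have j: "s j \<in> carrier G" "commuting (s j) a" "commuting (s j) f"
        using that bounds F(2) s_closed s_commute'[of j i] by (auto simp: a_def)
      then show ?thesis using C by (simp add: w_def commuting_mult)
    qed
    have w'_com: "commuting (s j) w'" if "i \<le> j" "Suc j < i + k" for j
    proof -
      have j: "s j \<in> carrier G" "commuting (s j) g" "commuting (s j) c"
        using that bounds 4 Gg(2) s_closed s_commute'[of j "i + k"] by (auto simp: c_def)
      then show ?thesis using C by (simp add: w'_def commuting_mult)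
    qed
    have aw': "a \<otimes> w' \<otimes> a = w'"
      using w'_com[of i] 4 commuting_conj[OF C(1) sq(1) wC(2)] by (simp add: a_def)
    have wb: "w = b \<otimes> w' \<otimes> b"
    proof -
      have "b \<otimes> (b \<otimes> w \<otimes> b) \<otimes> b = w"
        using C wC B(1) by (simp add: m_assoc involution_cancel)
      then show ?thesis using conj aw' by simp
    qed
    have w_com': "commuting (s j) w" if "Suc i \<le> j" "j \<le> i + k" for j
    proof (cases "j = Suc i")
      case True
      have "s (Suc i) \<in> carrier G" using bounds 4 s_closed by auto
      moreover have "commuting (s (Suc i)) b" using B(2) by simp
      moreover have "commuting (s (Suc i)) w'" using w'_com 4 by simp
      ultimately show ?thesis unfolding True wb using C wC by (simp add: commuting_mult)
    next
      case False
      then show ?thesis using w_com that by simp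
    qed
    have "commuting w (root (Suc i) (Suc l))"
    proof (rule commuting_root)
      show "commuting w (s j)" if "Suc i \<le> j" "j \<le> Suc i + Suc l" for j
        using w_com'[of j] that 4 by simp
    qed (use bounds 4 wC in auto)
    then have "b \<otimes> w \<otimes> b = w" using commuting_conj[OF C(2) B(1) wC(1)] by (simp add: b_def)
    then have ww': "w = w'" using conj aw' by simp
    have aw: "a \<otimes> w \<otimes> a = w" using aw' ww' by simp
    have "w \<otimes> (a \<otimes> w \<otimes> a) = \<one>"
    proof -
      have "w \<otimes> (a \<otimes> w \<otimes> a) = a \<otimes> f \<otimes> a \<otimes> (f \<otimes> f) \<otimes> a \<otimes> f \<otimes> a"
        unfolding w_def using C sq by (simp add: m_assoc involution_cancel)
      then show ?thesis using C sq F(1) by (simp add: m_assoc involution_cancel)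
    qed
    then have ww: "w \<otimes> w = \<one>" using aw by simp
    have R: "root i k = w" by (simp add: w_def a_def f_def 4)
    have "commuting (s j) w" if "i \<le> j" "j \<le> i + k" for j
    proof (cases "j = i")
      case True
      then show ?thesis using commuting_conj[OF C(1) sq(1) wC(1)] aw by (simp add: a_def)
    next
      case False
      then show ?thesis using w_com' that by simp
    qed
    moreover have "root i k = root i l' \<otimes> s (i + k) \<otimes> root i l' \<otimes> s (i + k)" if "k = Suc l'" for l'
    proof -
      have "root i l' = g" using that 4 by (simp add: g_def)
      then show ?thesis unfolding R ww' w'_def c_def by simp
    qed
    ultimately show ?thesis using ww R by auto
  qed
qed

text \<open>
  The root elements indexed by matrix positions, counted from 0.
\<close>

definition root_elt :: "nat \<Rightarrow> nat \<Rightarrow> 'a" where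
  "root_elt r c = root (Suc r) (c - Suc r)"

lemma root_elt_closed: "r < c \<Longrightarrow> c < n \<Longrightarrow> root_elt r c \<in> carrier G"
  by (simp add: root_elt_def root_closed)

lemma root_elt_square: "r < c \<Longrightarrow> c < n \<Longrightarrow> root_elt r c \<otimes> root_elt r c = \<one>"
  using root_central[of "Suc r" "c - Suc r"] by (simp add: root_elt_def)

lemma root_elt_commute:
  assumes "r < c" "c < n" "0 < j" "j \<le> c" "j \<noteq> r"
  shows "commuting (s j) (root_elt r c)"
proof (cases "j < r")
  case True
  then show ?thesis
    unfolding root_elt_def using assms by (intro commuting_root s_closed s_commute') auto
next
  case False
  then show ?thesis using root_central[of "Suc r" "c - Suc r"] assms by (simp add: root_elt_def)
qed

text \<open>
  This is the only case in which a generator does not commute with a root element of a later column;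
  it mirrors the row operation that adds row \<open>r\<close> to row \<open>r - 1\<close>.
\<close>

lemma s_root_elt:
  assumes "0 < r" "r < c" "c < n"
  shows "s r \<otimes> root_elt r c = root_elt (r - 1) c \<otimes> root_elt r c \<otimes> s r"
proof -
  have C: "s r \<in> carrier G" "root_elt r c \<in> carrier G" using assms s_closed root_elt_closed by auto
  have "c - r = Suc (c - Suc r)" using assms by auto
  then have "root_elt (r - 1) c = s r \<otimes> root_elt r c \<otimes> s r \<otimes> root_elt r c" using assms by (simp add: root_elt_def)
  moreover have "s r \<otimes> s r = \<one>" using assms s_square by auto
  ultimately show ?thesis
    using C root_elt_square[OF assms(2,3)] by (simp add: m_assoc involution_cancel)
qed

lemma s_eq_root_elt: "0 < c \<Longrightarrow> root_elt (c - 1) c = s c"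
  by (simp add: root_elt_def)

text \<open>
  The product of the root elements at the nonzero positions of column \<open>c\<close> in the first \<open>t\<close> rows. A
  matrix over the field with two elements is represented by the predicate of its nonzero positions.
\<close>

primrec col_word :: "(nat \<Rightarrow> nat \<Rightarrow> bool) \<Rightarrow> nat \<Rightarrow> nat \<Rightarrow> 'a" where
  "col_word A c 0 = \<one>"
| "col_word A c (Suc t) = col_word A c t \<otimes> (if A t c then root_elt t c else \<one>)"

text \<open>
  The last column stands on the left. In this order a generator that is multiplied from the left
  passes through the columns until it is absorbed by its own column.
\<close>

primrec normal_form :: "(nat \<Rightarrow> nat \<Rightarrow> bool) \<Rightarrow> nat \<Rightarrow> 'a" where
  "normal_form A 0 = \<one>"
| "normal_form A (Suc c) = col_word A c c \<otimes> normal_form A c"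

definition add_row :: "nat \<Rightarrow> (nat \<Rightarrow> nat \<Rightarrow> bool) \<Rightarrow> nat \<Rightarrow> nat \<Rightarrow> bool" where
  "add_row j A = (\<lambda>r c. if Suc r = j then A r c \<noteq> A j c else A r c)"

lemma col_word_closed: "t \<le> c \<Longrightarrow> c < n \<Longrightarrow> col_word A c t \<in> carrier G"
  by (induction t) (auto simp: root_elt_closed)

lemma normal_form_closed: "c \<le> n \<Longrightarrow> normal_form A c \<in> carrier G"
  by (induction c) (auto simp: col_word_closed)

lemma entry_commute:
  assumes "t < c" "c < n" "0 < j" "j \<le> c" "j \<noteq> t"
  shows "commuting (s j) (if A t c then root_elt t c else \<one>)"
  using root_elt_commute[OF assms] s_closed assms by auto

lemma entry_closed: "t < c \<Longrightarrow> c < n \<Longrightarrow> (if A t c then root_elt t c else \<one>) \<in> carrier G"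
  by (simp add: root_elt_closed)

lemma col_word_above:
  assumes "0 < j" "j \<le> c" "c < n" "t < j"
  shows "s j \<otimes> col_word A c t = col_word (add_row j A) c t \<otimes> s j"
  using assms(4)
proof (induction t)
  case 0
  then show ?case using assms s_closed by auto
next
  case (Suc t)
  let ?E = "if A t c then root_elt t c else \<one>"
  have C: "s j \<in> carrier G" "col_word A c t \<in> carrier G" "col_word (add_row j A) c t \<in> carrier G"
    using Suc.prems assms s_closed by (auto intro!: col_word_closed)
  have E: "?E \<in> carrier G" using Suc.prems assms by (intro entry_closed) auto
  have "add_row j A t c = A t c" using Suc.prems by (simp add: add_row_def)
  moreover have "commuting (s j) ?E" using Suc.prems assms by (intro entry_commute) auto
  moreover have "s j \<otimes> col_word A c t = col_word (add_row j A) c t \<otimes> s j" using Suc by simp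
  ultimately show ?case using pass_through[OF C E] by simp
qed

text \<open>
  The generator commutes with every root element of the column except the one in row \<open>j\<close>. Passing
  that one creates the root element in row \<open>j - 1\<close>, which cancels or supplements the one that is
  already there. Therefore rows \<open>j - 1\<close> and \<open>j\<close> are treated in one step, the base case.
\<close>

lemma col_word_below:
  assumes j: "0 < j" "j < c" "c < n" and t: "Suc j \<le> t" "t \<le> c"
  shows "s j \<otimes> col_word A c t = col_word (add_row j A) c t \<otimes> s j"
  using t
proof (induction t rule: nat_induct_at_least)
  case base
  obtain p where p: "j = Suc p" using j by (cases j) auto
  let ?w = "col_word A c p" and ?w' = "col_word (add_row j A) c p"
  let ?P = "root_elt p c" and ?J = "root_elt j c" and ?Ep = "if A p c then root_elt p c else \<one>" and ?Ej = "if A j c then root_elt j c else \<one>"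
  have C: "s j \<in> carrier G" "?w \<in> carrier G" "?w' \<in> carrier G" "?P \<in> carrier G" "?J \<in> carrier G"
    using j p s_closed by (auto intro!: col_word_closed root_elt_closed)
  have w: "s j \<otimes> ?w = ?w' \<otimes> s j" using col_word_above[of j c p] j p by simp
  have PP: "?P \<otimes> ?P = \<one>" using root_elt_square j p by auto
  have sP: "commuting (s j) ?Ep" using j p by (intro entry_commute) auto
  have sJ: "s j \<otimes> ?J = ?P \<otimes> ?J \<otimes> s j" using s_root_elt[of j c] j p by simp
  have E: "col_word (add_row j A) c (Suc j) = ?w' \<otimes> (if A p c \<noteq> A j c then ?P else \<one>) \<otimes> ?Ej"
    by (simp add: p add_row_def)
  have Ep: "?Ep \<in> carrier G" "?Ej \<in> carrier G" using C by auto
  have "s j \<otimes> col_word A c (Suc j) = s j \<otimes> (?w \<otimes> ?Ep \<otimes> ?Ej)" by (simp add: p)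
  also have "\<dots> = (s j \<otimes> ?w) \<otimes> ?Ep \<otimes> ?Ej" using C Ep by (simp add: m_assoc del: if_split)
  also have "\<dots> = ?w' \<otimes> (s j \<otimes> ?Ep) \<otimes> ?Ej" unfolding w using C Ep by (simp add: m_assoc del: if_split)
  also have "\<dots> = ?w' \<otimes> ?Ep \<otimes> (s j \<otimes> ?Ej)" unfolding sP using C Ep by (simp add: m_assoc del: if_split)
  also have "\<dots> = ?w' \<otimes> (if A p c \<noteq> A j c then ?P else \<one>) \<otimes> ?Ej \<otimes> s j"
    using C PP by (auto simp: sJ m_assoc involution_cancel[OF C(4) PP])
  finally show ?case unfolding E .
next
  case (Suc t)
  let ?E = "if A t c then root_elt t c else \<one>"
  have C: "s j \<in> carrier G" "col_word A c t \<in> carrier G" "col_word (add_row j A) c t \<in> carrier G"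
    using Suc j s_closed by (auto intro!: col_word_closed)
  have E: "?E \<in> carrier G" using Suc j by (intro entry_closed) auto
  have "add_row j A t c = A t c" using Suc by (simp add: add_row_def)
  moreover have "commuting (s j) ?E" using Suc j by (intro entry_commute) auto
  moreover have "s j \<otimes> col_word A c t = col_word (add_row j A) c t \<otimes> s j" using Suc by simp
  ultimately show ?case using pass_through[OF C E] by simp
qed

text \<open>
  In column \<open>c\<close> the generator \<open>s c\<close> is itself the root element in row \<open>c - 1\<close>, and adding the diagonal
  entry of row \<open>c\<close> to row \<open>c - 1\<close> toggles that position.
\<close>

lemma col_word_diagonal:
  assumes "0 < c" "c < n" "A c c"
  shows "s c \<otimes> col_word A c c = col_word (add_row c A) c c"
proof -
  obtain p where p: "c = Suc p" using assms by (cases c) auto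
  have C: "s c \<in> carrier G" "col_word A c p \<in> carrier G" "col_word (add_row c A) c p \<in> carrier G"
    using assms p s_closed by (auto intro!: col_word_closed)
  have w: "s c \<otimes> col_word A c p = col_word (add_row c A) c p \<otimes> s c"
    using col_word_above[of c c p] assms p by simp
  have sq: "s c \<otimes> s c = \<one>" using s_square assms by auto
  have xs: "root_elt p c = s c" using s_eq_root_elt[of c] p by simp
  have "s c \<otimes> col_word A c c = s c \<otimes> col_word A c p \<otimes> (if A p c then s c else \<one>)"
    using C xs by (auto simp: p m_assoc)
  also have "\<dots> = col_word (add_row c A) c p \<otimes> (s c \<otimes> (if A p c then s c else \<one>))"
    unfolding w using C by (auto simp: m_assoc)
  also have "\<dots> = col_word (add_row c A) c p \<otimes> (if A p c \<noteq> A c c then s c else \<one>)"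
    using assms(3) sq C by auto
  also have "\<dots> = col_word (add_row c A) c c"
    using xs by (simp add: p add_row_def)
  finally show ?thesis .
qed

lemma col_word_cong: "(\<And>r. r < t \<Longrightarrow> A r c = B r c) \<Longrightarrow> col_word A c t = col_word B c t"
  by (induction t) auto

text \<open>
  Left multiplication by a generator is a row operation on the normal form. Columns before column
  \<open>j\<close> are not affected by the row operation, and the generator never reaches them.
\<close>

lemma normal_form_step:
  assumes j: "0 < j" "j < n" and diag: "\<And>c. c < n \<Longrightarrow> A c c"
  shows "c \<le> n \<Longrightarrow> (if j < c then s j \<otimes> normal_form A c else normal_form A c) = normal_form (add_row j A) c"
proof (induction c)
  case (Suc c)
  let ?B = "add_row j A"
  have C: "s j \<in> carrier G" "col_word A c c \<in> carrier G" "col_word ?B c c \<in> carrier G"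
    "normal_form A c \<in> carrier G" "normal_form ?B c \<in> carrier G"
    using Suc.prems j s_closed by (auto intro!: col_word_closed normal_form_closed)
  have IH: "(if j < c then s j \<otimes> normal_form A c else normal_form A c) = normal_form ?B c" using Suc by simp
  consider "c < j" | "c = j" | "j < c" by linarith
  then show ?case
  proof cases
    case 1
    then have "col_word A c c = col_word ?B c c" by (intro col_word_cong) (auto simp: add_row_def)
    then show ?thesis using 1 IH by simp
  next
    case 2
    have d: "s j \<otimes> col_word A c c = col_word ?B c c"
      using 2 col_word_diagonal[of j A] j diag by simp
    have nf: "normal_form ?B c = normal_form A c" using 2 IH by simp
    have "s j \<otimes> normal_form A (Suc c) = s j \<otimes> col_word A c c \<otimes> normal_form A c"
      using C by (simp add: m_assoc)
    then show ?thesis using 2 d nf by simp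
  next
    case 3
    have d: "s j \<otimes> col_word A c c = col_word ?B c c \<otimes> s j"
      using 3 col_word_below[of j c c A] j Suc.prems by simp
    have nf: "normal_form ?B c = s j \<otimes> normal_form A c" using 3 IH by simp
    have "s j \<otimes> normal_form A (Suc c) = s j \<otimes> col_word A c c \<otimes> normal_form A c"
      using C by (simp add: m_assoc)
    also have "\<dots> = col_word ?B c c \<otimes> (s j \<otimes> normal_form A c)"
      unfolding d using C by (simp add: m_assoc)
    finally show ?thesis using 3 nf by simp
  qed
qed simp

lemma normal_form_one: "normal_form (\<lambda>r c. r = c) c = \<one>"
proof (induction c)
  case (Suc c)
  have "col_word (\<lambda>r c. r = c) c t = \<one>" if "t \<le> c" for t
    using that by (induction t) auto
  then show ?case using Suc by simp
qed simp

lemma normal_form_cong: "(\<And>r k. r < k \<Longrightarrow> k < c \<Longrightarrow> A r k = B r k) \<Longrightarrow> normal_form A c = normal_form B c"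
proof (induction c)
  case (Suc c)
  then have "col_word A c c = col_word B c c" by (intro col_word_cong) auto
  then show ?case using Suc by simp
qed simp

end

section \<open>Groups presented by generators and relators\<close>

lemma word_eq_gwords: "word_eq S R v w \<Longrightarrow> v \<in> gwords S \<and> w \<in> gwords S"
  by (induction rule: word_eq.induct) (auto simp: gwords_def)

lemma word_class_eq_iff:
  assumes "u \<in> gwords S"
  shows "word_class S R u = word_class S R v \<longleftrightarrow> word_eq S R u v"
proof
  assume "word_class S R u = word_class S R v"
  then show "word_eq S R u v" using word_eq.refl[OF assms] word_eq.sym unfolding word_class_def by blast
next
  assume "word_eq S R u v"
  then show "word_class S R u = word_class S R v"
    unfolding word_class_def using word_eq.sym word_eq.trans by blast
qed

lemma gwords_append: "u \<in> gwords S \<Longrightarrow> v \<in> gwords S \<Longrightarrow> u @ v \<in> gwords S"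
  by (simp add: gwords_def)

lemma presented_group_mult:
  assumes "u \<in> gwords S" "v \<in> gwords S"
  shows "word_class S R u \<otimes>\<^bsub>presented_group S R\<^esub> word_class S R v = word_class S R (u @ v)"
proof -
  have "word_class S R (a @ b) = word_class S R (u @ v)"
    if "a \<in> word_class S R u" "b \<in> word_class S R v" for a b
  proof -
    have "word_eq S R (u @ v) (a @ b)" using that by (auto simp: word_class_def intro: word_eq.append)
    then show ?thesis using word_class_eq_iff[of "u @ v" S R "a @ b"] assms gwords_append by metis
  qed
  moreover have "u \<in> word_class S R u" "v \<in> word_class S R v"
    using assms by (auto simp: word_class_def intro: word_eq.refl)
  ultimately have "(\<Union>a \<in> word_class S R u. \<Union>b \<in> word_class S R v. word_class S R (a @ b)) = word_class S R (u @ v)"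
    by blast
  then show ?thesis by (simp add: presented_group_def)
qed

definition inverse_word :: "'s gword \<Rightarrow> 's gword" where
  "inverse_word w = rev (map (\<lambda>(s, b). (s, \<not> b)) w)"

lemma inverse_word_gwords: "w \<in> gwords S \<Longrightarrow> inverse_word w \<in> gwords S"
  by (auto simp: inverse_word_def gwords_def)

lemma inverse_word_left: "w \<in> gwords S \<Longrightarrow> word_eq S R (inverse_word w @ w) []"
proof (induction w)
  case Nil
  then show ?case by (simp add: inverse_word_def word_eq.refl gwords_def)
next
  case (Cons l w)
  obtain s b where l: "l = (s, b)" by (cases l)
  have w: "w \<in> gwords S" and s: "s \<in> S" using Cons.prems by (auto simp: gwords_def l)
  have "word_eq S R [(s, \<not> b), (s, b)] []" using word_eq.cancel[OF s, of R "\<not> b"] by simp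
  then have "word_eq S R ([(s, \<not> b), (s, b)] @ w) ([] @ w)"
    using word_eq.refl[OF w] by (rule word_eq.append)
  then have "word_eq S R (inverse_word w @ ([(s, \<not> b), (s, b)] @ w)) (inverse_word w @ ([] @ w))"
    by (rule word_eq.append[OF word_eq.refl[OF inverse_word_gwords[OF w]]])
  then have "word_eq S R (inverse_word (l # w) @ l # w) (inverse_word w @ w)"
    by (simp add: inverse_word_def l)
  then show ?case using Cons.IH[OF w] word_eq.trans by blast
qed

lemma group_presented_group: "group (presented_group S R)"
proof (rule groupI)
  let ?G = "presented_group S R"
  have carr: "carrier ?G = word_class S R ` gwords S" and one: "\<one>\<^bsub>?G\<^esub> = word_class S R []"
    by (simp_all add: presented_group_def)
  have nil: "[] \<in> gwords S" by (simp add: gwords_def)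
  show "\<one>\<^bsub>?G\<^esub> \<in> carrier ?G" using nil by (simp add: carr one)
  fix x y z assume "x \<in> carrier ?G"
  then obtain u where u: "x = word_class S R u" "u \<in> gwords S" by (auto simp: carr)
  show "\<one>\<^bsub>?G\<^esub> \<otimes>\<^bsub>?G\<^esub> x = x" using u nil by (simp add: one presented_group_mult)
  show "\<exists>y \<in> carrier ?G. y \<otimes>\<^bsub>?G\<^esub> x = \<one>\<^bsub>?G\<^esub>"
  proof (rule bexI)
    show "word_class S R (inverse_word u) \<in> carrier ?G" using u inverse_word_gwords by (auto simp: carr)
    have "word_class S R (inverse_word u @ u) = word_class S R []"
      using inverse_word_left[OF u(2)] word_class_eq_iff[of "inverse_word u @ u" S R "[]"] u inverse_word_gwords gwords_append
      by metis
    then show "word_class S R (inverse_word u) \<otimes>\<^bsub>?G\<^esub> x = \<one>\<^bsub>?G\<^esub>"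
      using presented_group_mult[OF inverse_word_gwords[OF u(2)] u(2), of R] u(1) by (simp add: one)
  qed
  assume "y \<in> carrier ?G"
  then obtain v where v: "y = word_class S R v" "v \<in> gwords S" by (auto simp: carr)
  show "x \<otimes>\<^bsub>?G\<^esub> y \<in> carrier ?G" using u v by (auto simp: presented_group_mult carr gwords_append)
  assume "z \<in> carrier ?G"
  then obtain w where w: "z = word_class S R w" "w \<in> gwords S" by (auto simp: carr)
  show "x \<otimes>\<^bsub>?G\<^esub> y \<otimes>\<^bsub>?G\<^esub> z = x \<otimes>\<^bsub>?G\<^esub> (y \<otimes>\<^bsub>?G\<^esub> z)"
    using u v w by (simp add: presented_group_mult gwords_append)
qed

primrec eval_word :: "('a, 'b) monoid_scheme \<Rightarrow> ('s \<Rightarrow> 'a) \<Rightarrow> 's gword \<Rightarrow> 'a" where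
  "eval_word G s [] = \<one>\<^bsub>G\<^esub>"
| "eval_word G s (l # w) = (if snd l then s (fst l) else inv\<^bsub>G\<^esub> s (fst l)) \<otimes>\<^bsub>G\<^esub> eval_word G s w"

context group
begin

lemma eval_word_closed:
  assumes "\<And>i. i \<in> S \<Longrightarrow> s i \<in> carrier G" "w \<in> gwords S"
  shows "eval_word G s w \<in> carrier G"
  using assms(2) by (induction w) (auto simp: gwords_def assms(1))

lemma eval_word_append:
  assumes "\<And>i. i \<in> S \<Longrightarrow> s i \<in> carrier G" "u \<in> gwords S" "v \<in> gwords S"
  shows "eval_word G s (u @ v) = eval_word G s u \<otimes> eval_word G s v"
  using assms(2)
proof (induction u)
  case Nil
  then show ?case using eval_word_closed[OF assms(1,3)] by simp
next
  case (Cons l u)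
  then have "u \<in> gwords S" "fst l \<in> S" by (auto simp: gwords_def)
  then show ?case
    using Cons.IH assms(1)[of "fst l"] eval_word_closed[OF assms(1,3)] eval_word_closed[OF assms(1), where w = u]
    by (simp add: m_assoc)
qed

text \<open>
  The universal property of the presentation: a word congruence is respected by every assignment of
  group elements to the generators that satisfies the relators.
\<close>

lemma eval_word_respects:
  assumes s: "\<And>i. i \<in> S \<Longrightarrow> s i \<in> carrier G" and R: "\<And>r. r \<in> R \<Longrightarrow> eval_word G s r = \<one>"
    and "word_eq S R v w"
  shows "eval_word G s v = eval_word G s w"
  using assms(3)
proof (induction rule: word_eq.induct)
  case (append u u' v v')
  then have g: "u \<in> gwords S" "u' \<in> gwords S" "v \<in> gwords S" "v' \<in> gwords S"
    using word_eq_gwords by blast+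
  show ?case
    using append.IH eval_word_append[of S s u v, OF s g(1,3)] eval_word_append[of S s u' v', OF s g(2,4)] by simp
next
  case (cancel i b)
  then show ?case using s[OF cancel] by (cases b) simp_all
qed (simp_all add: R)

lemma eval_power_word:
  assumes s: "\<And>i. i \<in> S \<Longrightarrow> s i \<in> carrier G" and "set xs \<subseteq> S"
  shows "eval_word G s (power_word xs m) = eval_word G s (map (\<lambda>i. (i, True)) xs) [^] m"
    "power_word xs m \<in> gwords S"
proof -
  have g: "map (\<lambda>i. (i, True)) xs \<in> gwords S" using assms(2) by (auto simp: gwords_def)
  show p: "power_word xs m \<in> gwords S" for m
    unfolding power_word_def using g by (induction m) (auto simp: gwords_def)
  show "eval_word G s (power_word xs m) = eval_word G s (map (\<lambda>i. (i, True)) xs) [^] m"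
  proof (induction m)
    case (Suc m)
    have "power_word xs (Suc m) = map (\<lambda>i. (i, True)) xs @ power_word xs m" by (simp add: power_word_def)
    then have "eval_word G s (power_word xs (Suc m)) = eval_word G s (map (\<lambda>i. (i, True)) xs) \<otimes> eval_word G s (power_word xs m)"
      using eval_word_append[of S s, OF s g p] by simp
    then show ?case using Suc nat_pow_Suc2[OF eval_word_closed[of S s, OF s g]] by simp
  qed (simp add: power_word_def)
qed

end

lemma (in group_hom) hom_eval_word:
  assumes "\<And>i. i \<in> S \<Longrightarrow> s i \<in> carrier G" "w \<in> gwords S"
  shows "h (eval_word G s w) = eval_word H (\<lambda>i. h (s i)) w"
  using assms(2)
proof (induction w)
  case (Cons l w)
  then have "w \<in> gwords S" "fst l \<in> S" by (auto simp: gwords_def)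
  then show ?case
    using Cons.IH assms(1)[of "fst l"] G.eval_word_closed[OF assms(1), where w = w] by simp
qed simp

lemma eval_word_presented_group:
  assumes "w \<in> gwords S"
  shows "eval_word (presented_group S R) (\<lambda>i. word_class S R [(i, True)]) w = word_class S R w"
  using assms
proof (induction w)
  case Nil
  then show ?case by (simp add: presented_group_def)
next
  case (Cons l w)
  obtain i b where l: "l = (i, b)" by (cases l)
  have w: "w \<in> gwords S" and i: "i \<in> S" using Cons.prems by (auto simp: gwords_def l)
  interpret group "presented_group S R" by (rule group_presented_group)
  have g: "[(i, c)] \<in> gwords S" for c using i by (simp add: gwords_def)
  have "[(i, False)] @ [(i, True)] \<in> gwords S" using i by (simp add: gwords_def)
  then have "word_class S R ([(i, False)] @ [(i, True)]) = word_class S R []"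
    using word_eq.cancel[OF i, of R False] word_class_eq_iff by fastforce
  then have "word_class S R [(i, False)] \<otimes>\<^bsub>presented_group S R\<^esub> word_class S R [(i, True)] = \<one>\<^bsub>presented_group S R\<^esub>"
    using presented_group_mult[OF g g, of R] by (simp add: presented_group_def)
  moreover have "word_class S R [(i, c)] \<in> carrier (presented_group S R)" for c
    using g by (simp add: presented_group_def)
  ultimately have "inv\<^bsub>presented_group S R\<^esub> (word_class S R [(i, True)]) = word_class S R [(i, False)]"
    by (intro inv_equality) auto
  then have "eval_word (presented_group S R) (\<lambda>i. word_class S R [(i, True)]) (l # w)
      = word_class S R [(i, b)] \<otimes>\<^bsub>presented_group S R\<^esub> word_class S R w"
    using Cons.IH[OF w] l by auto
  also have "\<dots> = word_class S R ([l] @ w)" unfolding l by (rule presented_group_mult[OF g w])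
  finally show ?case by simp
qed

lemma (in group) involutions_commute:
  assumes "a \<in> carrier G" "b \<in> carrier G" "a \<otimes> a = \<one>" "b \<otimes> b = \<one>"
  shows "(a \<otimes> b) [^] (2::nat) = \<one> \<longleftrightarrow> a \<otimes> b = b \<otimes> a"
proof -
  have "(a \<otimes> b) [^] (2::nat) = a \<otimes> b \<otimes> (a \<otimes> b)" using assms by (simp add: numeral_2_eq_2)
  moreover have "(b \<otimes> a) \<otimes> (a \<otimes> b) = \<one>"
    using assms by (simp add: m_assoc involution_cancel)
  ultimately show ?thesis
    using assms by (metis inv_equality m_closed)
qed

section \<open>A presentation of the unitriangular group\<close>

text \<open>
  The value of a word in any group that satisfies the relations is determined by the matrix that it
  represents: the letters act on the normal form as they act on the matrix.
\<close>

lemma (in UT_relations) eval_word_normal_form: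
  assumes "w \<in> gwords {1..n - 1}"
  shows "eval_word G s w = normal_form (\<lambda>r c. eval_word (UT n) (transvection n) w $$ (r, c) = 1) n"
  using assms
proof (induction w)
  case Nil
  have "normal_form (\<lambda>r c. (1\<^sub>m n :: bit mat) $$ (r, c) = 1) n = normal_form (\<lambda>r c. r = c) n"
    by (rule normal_form_cong) auto
  then show ?case by (simp add: UT_simps normal_form_one)
next
  case (Cons l w)
  obtain i b where l: "l = (i, b)" by (cases l)
  have w: "w \<in> gwords {1..n - 1}" and i: "i \<in> {1..n - 1}" using Cons.prems by (auto simp: gwords_def l)
  interpret U: group "UT n" by (rule group_UT)
  let ?M = "eval_word (UT n) (transvection n) w"
  let ?A = "\<lambda>r c. ?M $$ (r, c) = 1"
  have M: "?M \<in> carrier (UT n)"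
    using U.eval_word_closed[OF transvection_in_UT w] .
  then have Mc: "?M \<in> carrier_mat n n" and Md: "\<And>c. c < n \<Longrightarrow> ?A c c"
    by (auto simp: carrier_UT unipotent_def)
  have "inv s i = s i" using i s_closed s_square by (intro inv_equality) auto
  then have "eval_word G s (l # w) = s i \<otimes> normal_form ?A n"
    using Cons.IH[OF w] by (simp add: l)
  also have "\<dots> = normal_form (add_row i ?A) n"
    using normal_form_step[of i ?A n] i Md by auto
  also have "\<dots> = normal_form (\<lambda>r c. (transvection n i * ?M) $$ (r, c) = 1) n"
  proof (rule normal_form_cong)
    fix r k assume rk: "r < k" "k < n"
    have "(x + y = 1) = ((y = 1) \<noteq> (x = 1))" for x y :: bit by (cases x; cases y) simp_all
    then show "add_row i ?A r k = ((transvection n i * ?M) $$ (r, k) = 1)"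
      using rk UT_word_simps(2)[OF i Mc, of r k] by (simp add: add_row_def del: index_mult_mat(1) add_bit_eq_xor)
  qed
  also have "transvection n i * ?M = eval_word (UT n) (transvection n) (l # w)"
  proof -
    have "inv\<^bsub>UT n\<^esub> (transvection n i) = transvection n i"
      using i transvection_in_UT transvection_square by (intro U.inv_equality) auto
    then show ?thesis by (simp add: l UT_simps)
  qed
  finally show ?case .
qed

lemma UT_coxeter_relators:
  assumes "r \<in> coxeter4_relators n"
  shows "eval_word (UT n) (transvection n) r = \<one>\<^bsub>UT n\<^esub>"
proof -
  interpret group "UT n" by (rule group_UT)
  let ?t = "transvection n"
  note pw = eval_power_word(1)[of "{1..n - 1}" ?t, OF transvection_in_UT]
  consider i where "i \<in> {1..n - 1}" "r = power_word [i] 2"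
    | i where "i \<in> {1..n - 2}" "r = power_word [i, i + 1] 4"
    | i j where "i \<in> {1..n - 1}" "j \<in> {1..n - 1}" "\<bar>int i - int j\<bar> \<ge> 2" "r = power_word [i, j] 2"
    using assms unfolding coxeter4_relators_def by blast
  then show ?thesis
  proof cases
    case (1 i)
    then show ?thesis
      using pw[of "[i]" 2] transvection_square[of i n] transvection_in_UT[of i n] by (simp add: numeral_2_eq_2)
  next
    case (2 i)
    then have "i \<in> {1..n - 1}" "i + 1 \<in> {1..n - 1}" by auto
    then show ?thesis
      using pw[of "[i, i + 1]" 4] 2 transvection_braid(1)[of i n] transvection_in_UT[of _ n] by simp
  next
    case (3 i j)
    then have "Suc i < j \<or> Suc j < i" by linarith
    then have "?t i \<otimes>\<^bsub>UT n\<^esub> ?t j = ?t j \<otimes>\<^bsub>UT n\<^esub> ?t i"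
      using transvection_commute[of i n j] transvection_commute[of j n i] 3 by (auto simp: UT_simps)
    then have "(?t i \<otimes>\<^bsub>UT n\<^esub> ?t j) [^]\<^bsub>UT n\<^esub> (2::nat) = \<one>\<^bsub>UT n\<^esub>"
      using involutions_commute[of "?t i" "?t j"] 3 transvection_in_UT[of _ n] transvection_square[of _ n] by blast
    then show ?thesis
      using pw[of "[i, j]" 2] 3 transvection_in_UT[of _ n] by simp
  qed
qed

lemma carrier_UT_generated: "carrier (UT n) = generate (UT n) (transvection n ` {1..n - 1})"
proof -
  have "unipotent n (<) = unipotent n (connected_in {1..n - 1})"
    unfolding unipotent_def connected_in_def by auto
  then show ?thesis using generate_transvections[of "{1..n - 1}" n] by (simp add: carrier_UT)
qed

lemma UT_eval_word_surj:
  assumes "A \<in> carrier (UT n)"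
  shows "\<exists>w \<in> gwords {1..n - 1}. eval_word (UT n) (transvection n) w = A"
proof -
  interpret group "UT n" by (rule group_UT)
  note cl = transvection_in_UT[of _ n]
  have letter: "[(i, b)] \<in> gwords {1..n - 1}" if "i \<in> {1..n - 1}" for i b using that by (simp add: gwords_def)
  from assms show ?thesis
    unfolding carrier_UT_generated
  proof (induction rule: generate.induct)
    case one
    then show ?case by (intro bexI[of _ "[]"]) (auto simp: gwords_def)
  next
    case (incl h)
    then obtain i where i: "i \<in> {1..n - 1}" "h = transvection n i" by blast
    then show ?case using cl letter[OF i(1)] by (intro bexI[of _ "[(i, True)]"]) auto
  next
    case (inv h)
    then obtain i where i: "i \<in> {1..n - 1}" "h = transvection n i" by blast
    then show ?case using cl letter[OF i(1)] by (intro bexI[of _ "[(i, False)]"]) auto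
  next
    case (eng h1 h2)
    then obtain u v where "u \<in> gwords {1..n - 1}" "eval_word (UT n) (transvection n) u = h1"
      "v \<in> gwords {1..n - 1}" "eval_word (UT n) (transvection n) v = h2" by blast
    then show ?case using eval_word_append[of "{1..n - 1}" "transvection n", OF cl] by (intro bexI[of _ "u @ v"]) (auto intro: gwords_append)
  qed
qed

text \<open>
  The evaluation of words in the unitriangular group is a homomorphism of the Coxeter group onto it,
  and its kernel contains the extra relators. Conversely let \<open>N\<close> be a normal subgroup that contains
  them. The quotient by \<open>N\<close> satisfies all relations, so a word with trivial matrix is trivial in the
  quotient and its class lies in \<open>N\<close>. Thus the kernel is the normal closure of the extra relators.
\<close>

theorem UT_iso_coxeter4_quotient:
  "UT n \<cong> coxeter4 n Mod normal_closure (coxeter4 n) (coxeter4_extra n)"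
proof -
  note One_nat_def [simp del]
  let ?S = "{1..n - 1}" and ?R = "coxeter4_relators n" and ?C = "coxeter4 n" and ?t = "transvection n"
  let ?cl = "word_class ?S ?R" and ?ev = "eval_word (UT n) ?t" and ?g = "coxeter4_gen n"
  interpret U: group "UT n" by (rule group_UT)
  interpret C: group ?C unfolding coxeter4_def by (rule group_presented_group)
  have carr: "carrier ?C = ?cl ` gwords ?S" by (simp add: coxeter4_def presented_group_def)
  have g_closed: "?g i \<in> carrier ?C" if "i \<in> ?S" for i
    using that unfolding carr coxeter4_gen_def by (auto simp: gwords_def)
  have eval_C: "eval_word ?C ?g w = ?cl w" if "w \<in> gwords ?S" for w
    using eval_word_presented_group[OF that, of ?R] by (simp add: coxeter4_def coxeter4_gen_def[abs_def])
  have relator_C: "eval_word ?C ?g r = \<one>\<^bsub>?C\<^esub>" if "r \<in> ?R" "r \<in> gwords ?S" for r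
    unfolding eval_C[OF that(2)] using word_eq.relator[OF that] word_class_eq_iff[OF that(2), of ?R "[]"]
    by (simp add: coxeter4_def presented_group_def)
  define \<phi> where "\<phi> X = the_elem (?ev ` X)" for X
  have \<phi>: "\<phi> (?cl w) = ?ev w" if "w \<in> gwords ?S" for w
  proof -
    have "?ev v = ?ev w" if "v \<in> ?cl w" for v
      using U.eval_word_respects[OF transvection_in_UT UT_coxeter_relators, of ?S ?R w v] that
      by (simp add: word_class_def)
    moreover have "w \<in> ?cl w" using that by (simp add: word_class_def word_eq.refl)
    ultimately have "?ev ` ?cl w = {?ev w}" by blast
    then show ?thesis by (simp add: \<phi>_def)
  qed
  have hom: "\<phi> \<in> hom ?C (UT n)"
  proof (rule homI)
    fix x assume "x \<in> carrier ?C"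
    then show "\<phi> x \<in> carrier (UT n)"
      using U.eval_word_closed[of ?S ?t, OF transvection_in_UT] by (auto simp: carr \<phi>)
  next
    fix x y assume "x \<in> carrier ?C" "y \<in> carrier ?C"
    then obtain u v where uv: "x = ?cl u" "u \<in> gwords ?S" "y = ?cl v" "v \<in> gwords ?S" by (auto simp: carr)
    then have "x \<otimes>\<^bsub>?C\<^esub> y = ?cl (u @ v)" by (simp add: coxeter4_def presented_group_mult)
    then show "\<phi> (x \<otimes>\<^bsub>?C\<^esub> y) = \<phi> x \<otimes>\<^bsub>UT n\<^esub> \<phi> y"
      using uv U.eval_word_append[of ?S ?t, OF transvection_in_UT uv(2,4)] by (simp add: \<phi> gwords_append)
  qed
  interpret h: group_hom ?C "UT n" \<phi> by unfold_locales (rule hom)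
  have \<phi>_gen: "\<phi> (?g i) = ?t i" if "i \<in> ?S" for i
  proof -
    have "[(i, True)] \<in> gwords ?S" using that by (simp add: gwords_def)
    from \<phi>[OF this] show ?thesis using that transvection_in_UT[OF that] by (simp add: coxeter4_gen_def)
  qed
  have surj: "\<phi> ` carrier ?C = carrier (UT n)"
  proof
    show "carrier (UT n) \<subseteq> \<phi> ` carrier ?C"
    proof
      fix A assume "A \<in> carrier (UT n)"
      then obtain w where "w \<in> gwords ?S" "?ev w = A" using UT_eval_word_surj by blast
      then show "A \<in> \<phi> ` carrier ?C" using \<phi>[of w] carr by (metis imageI)
    qed
  qed auto
  have extra_kernel: "coxeter4_extra n \<subseteq> kernel ?C (UT n) \<phi>"
  proof
    fix x assume "x \<in> coxeter4_extra n"
    then obtain i where i: "i \<in> {1..n - 3}"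
      and x: "x = (?g i \<otimes>\<^bsub>?C\<^esub> ?g (i + 1) \<otimes>\<^bsub>?C\<^esub> ?g (i + 2)) [^]\<^bsub>?C\<^esub> (4::nat)"
      unfolding coxeter4_extra_def by blast
    have I: "i \<in> ?S" "i + 1 \<in> ?S" "i + 2 \<in> ?S" using i by auto
    have "\<phi> x = (?t i \<otimes>\<^bsub>UT n\<^esub> ?t (i + 1) \<otimes>\<^bsub>UT n\<^esub> ?t (i + 2)) [^]\<^bsub>UT n\<^esub> (4::nat)"
      unfolding x using g_closed[OF I(1)] g_closed[OF I(2)] g_closed[OF I(3)]
        \<phi>_gen[OF I(1)] \<phi>_gen[OF I(2)] \<phi>_gen[OF I(3)] by (simp add: h.hom_nat_pow)
    then show "x \<in> kernel ?C (UT n) \<phi>"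
      using transvection_triple[OF i] g_closed[OF I(1)] g_closed[OF I(2)] g_closed[OF I(3)]
      by (simp add: kernel_def x)
  qed
  have "kernel ?C (UT n) \<phi> \<subseteq> N" if N: "N \<lhd> ?C" "coxeter4_extra n \<subseteq> N" for N
  proof
    interpret N: normal N ?C by (rule N(1))
    let ?Q = "?C Mod N"
    interpret Q: group ?Q by (rule N.factorgroup_is_group)
    interpret p: group_hom ?C ?Q "\<lambda>a. N #>\<^bsub>?C\<^esub> a"
      by unfold_locales (rule N.r_coset_hom_Mod)
    define q where "q i = N #>\<^bsub>?C\<^esub> ?g i" for i
    have q_closed: "q i \<in> carrier ?Q" if "i \<in> ?S" for i
      unfolding q_def using p.hom_closed g_closed[OF that] by blast
    have eval_Q: "eval_word ?Q q w = N #>\<^bsub>?C\<^esub> ?cl w" if "w \<in> gwords ?S" for w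
      using p.hom_eval_word[of ?S ?g, OF g_closed that] eval_C[OF that] by (simp add: q_def[abs_def])
    have rel: "eval_word ?Q q (map (\<lambda>i. (i, True)) xs) [^]\<^bsub>?Q\<^esub> m = \<one>\<^bsub>?Q\<^esub>"
      if "power_word xs m \<in> ?R" "set xs \<subseteq> ?S" for xs and m :: nat
    proof -
      have w: "power_word xs m \<in> gwords ?S" using C.eval_power_word(2)[of ?S ?g, OF g_closed that(2)] .
      have "eval_word ?Q q (power_word xs m) = N #>\<^bsub>?C\<^esub> \<one>\<^bsub>?C\<^esub>"
        using relator_C[OF that(1) w] eval_C[OF w] eval_Q[OF w] by simp
      also have "\<dots> = \<one>\<^bsub>?Q\<^esub>" by (rule p.hom_one)
      finally show ?thesis using Q.eval_power_word(1)[of ?S q, OF q_closed that(2)] by simp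
    qed
    interpret UT_relations ?Q n q
    proof
      fix i assume i: "i \<in> ?S"
      show "q i \<in> carrier ?Q" using i by (rule q_closed)
      have "power_word [i] 2 \<in> ?R" using i unfolding coxeter4_relators_def by blast
      from rel[OF this] show sq: "q i \<otimes>\<^bsub>?Q\<^esub> q i = \<one>\<^bsub>?Q\<^esub>"
        using i q_closed[OF i] by (simp add: numeral_2_eq_2 del: mult_FactGroup one_FactGroup)
      fix j assume j: "j \<in> ?S" "Suc i < j"
      have sq': "q j \<otimes>\<^bsub>?Q\<^esub> q j = \<one>\<^bsub>?Q\<^esub>"
      proof -
        have "power_word [j] 2 \<in> ?R" using j unfolding coxeter4_relators_def by blast
        from rel[OF this] show ?thesis
          using j q_closed[OF j(1)] by (simp add: numeral_2_eq_2 del: mult_FactGroup one_FactGroup)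
      qed
      have "\<bar>int i - int j\<bar> \<ge> 2" using j by linarith
      then have "power_word [i, j] 2 \<in> ?R" using i j unfolding coxeter4_relators_def by blast
      from rel[OF this] have "(q i \<otimes>\<^bsub>?Q\<^esub> q j) [^]\<^bsub>?Q\<^esub> (2::nat) = \<one>\<^bsub>?Q\<^esub>"
        using i j q_closed[OF i] q_closed[OF j(1)] by (simp del: mult_FactGroup one_FactGroup)
      then show "q i \<otimes>\<^bsub>?Q\<^esub> q j = q j \<otimes>\<^bsub>?Q\<^esub> q i"
        using Q.involutions_commute[OF q_closed[OF i] q_closed[OF j(1)] sq sq'] by simp
    next
      fix i assume i: "i \<in> {1..n - 2}"
      then have I: "i \<in> ?S" "i + 1 \<in> ?S" by auto
      have "power_word [i, i + 1] 4 \<in> ?R" using i unfolding coxeter4_relators_def by blast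
      from rel[OF this] show "(q i \<otimes>\<^bsub>?Q\<^esub> q (i + 1)) [^]\<^bsub>?Q\<^esub> (4::nat) = \<one>\<^bsub>?Q\<^esub>"
        using I q_closed[OF I(1)] q_closed[OF I(2)] by (simp del: mult_FactGroup one_FactGroup)
    next
      fix i assume i: "i \<in> {1..n - 3}"
      then have I: "i \<in> ?S" "i + 1 \<in> ?S" "i + 2 \<in> ?S" by auto
      let ?x = "?g i \<otimes>\<^bsub>?C\<^esub> ?g (i + 1) \<otimes>\<^bsub>?C\<^esub> ?g (i + 2)"
      have xc: "?x \<in> carrier ?C" using g_closed[OF I(1)] g_closed[OF I(2)] g_closed[OF I(3)] by simp
      have "?x [^]\<^bsub>?C\<^esub> (4::nat) \<in> N" using i N(2) unfolding coxeter4_extra_def by blast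
      then have "N #>\<^bsub>?C\<^esub> (?x [^]\<^bsub>?C\<^esub> (4::nat)) = \<one>\<^bsub>?Q\<^esub>"
        using C.coset_join2[OF _ N.subgroup_axioms] xc by simp
      moreover have "N #>\<^bsub>?C\<^esub> (?x [^]\<^bsub>?C\<^esub> (4::nat)) = (N #>\<^bsub>?C\<^esub> ?x) [^]\<^bsub>?Q\<^esub> (4::nat)"
        using N.FactGroup_pow[OF xc] by simp
      moreover have "N #>\<^bsub>?C\<^esub> ?x = q i \<otimes>\<^bsub>?Q\<^esub> q (i + 1) \<otimes>\<^bsub>?Q\<^esub> q (i + 2)"
        using g_closed[OF I(1)] g_closed[OF I(2)] g_closed[OF I(3)] p.hom_mult unfolding q_def
        by (metis C.m_closed)
      ultimately show "(q i \<otimes>\<^bsub>?Q\<^esub> q (i + 1) \<otimes>\<^bsub>?Q\<^esub> q (i + 2)) [^]\<^bsub>?Q\<^esub> (4::nat) = \<one>\<^bsub>?Q\<^esub>"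
        by metis
    qed
    fix x assume "x \<in> kernel ?C (UT n) \<phi>"
    then obtain w where w: "x = ?cl w" "w \<in> gwords ?S" and "\<phi> x = \<one>\<^bsub>UT n\<^esub>" and xc: "x \<in> carrier ?C"
      unfolding kernel_def by (auto simp: carr)
    then have "?ev w = ?ev []" using \<phi> by simp
    moreover have "[] \<in> gwords ?S" by (simp add: gwords_def)
    ultimately have "eval_word ?Q q w = eval_word ?Q q []"
      using eval_word_normal_form[OF w(2)] eval_word_normal_form[of "[]"] by metis
    then have "N #>\<^bsub>?C\<^esub> x = N" using eval_Q[OF w(2)] w(1) by simp
    then show "x \<in> N" using C.rcos_self[OF xc N.subgroup_axioms] by simp
  qed
  then have "kernel ?C (UT n) \<phi> = normal_closure ?C (coxeter4_extra n)"
    unfolding normal_closure_def using h.normal_kernel extra_kernel by blast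
  moreover have "UT n \<cong> ?C Mod kernel ?C (UT n) \<phi>"
    using group.iso_sym[OF normal.factorgroup_is_group[OF h.normal_kernel]] h.FactGroup_iso[OF surj] .
  ultimately show ?thesis by simp
qed

section \<open>The polytope of the unitriangular group\<close>

text \<open>
  The intersection property holds because block patterns are conditions on single matrix entries.
\<close>

lemma UT_string_C_group: "string_C_group (UT n) {1..n - 1} (transvection n)"
proof -
  interpret group "UT n" by (rule group_UT)
  show ?thesis
  proof
    fix i assume i: "i \<in> {1..n - 1}"
    show "transvection n i \<noteq> \<one>\<^bsub>UT n\<^esub>"
    proof
      assume "transvection n i = \<one>\<^bsub>UT n\<^esub>"
      then have "transvection n i $$ (i - 1, i) = (1\<^sub>m n :: bit mat) $$ (i - 1, i)" by (simp add: UT_simps)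
      moreover have "i - 1 < n" "i < n" "i - 1 \<noteq> i" "Suc (i - 1) = i" using i by auto
      ultimately show False by (simp add: transvection_def del: One_nat_def)
    qed
  next
    fix J K assume JK: "J \<subseteq> {1..n - 1}" "K \<subseteq> {1..n - 1}"
    then have JK_Int: "J \<inter> K \<subseteq> {1..n - 1}" by auto
    show "generate (UT n) (transvection n ` J) \<inter> generate (UT n) (transvection n ` K)
        \<subseteq> generate (UT n) (transvection n ` (J \<inter> K))"
      unfolding generate_transvections[OF JK(1)] generate_transvections[OF JK(2)]
        generate_transvections[OF JK_Int]
      unfolding connected_in_Int by (rule unipotent_Int)
  next
    show "generate (UT n) (transvection n ` {1..n - 1}) = carrier (UT n)"
      using carrier_UT_generated by simp
  next
    fix i j assume "i \<in> {1..n - 1}" "j \<in> {1..n - 1}" "Suc i < j"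
    then show "transvection n i \<otimes>\<^bsub>UT n\<^esub> transvection n j = transvection n j \<otimes>\<^bsub>UT n\<^esub> transvection n i"
      unfolding UT_simps by (rule transvection_commute)
  qed (simp_all only: finite_atLeastAtMost transvection_in_UT transvection_square)
qed

theorem corollary4p5:
  fixes n :: nat
  assumes "n \<ge> 3"
  shows "abstract_regular_polytope (UT_incidence n)
       \<and> has_schlaefli_type (UT_incidence n) [1..<n] (replicate (n - 2) 4)
       \<and> automorphism_group (UT_incidence n)
           \<cong> coxeter4 n Mod normal_closure (coxeter4 n) (coxeter4_extra n)"
proof -
  note One_nat_def [simp del]
  interpret string_C_group "UT n" "{1..n - 1}" "transvection n" by (rule UT_string_C_group)
  have geom: "UT_incidence n = geom"
    by (simp add: UT_incidence_def geom_def P_def UT_maximal_parabolic_def[abs_def])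
  have nth: "[1..<n] ! i = Suc i" if "i < n - 1" for i using that by (simp add: nth_upt)
  have octagon: "cycle_incidence_graph \<Delta> 8" "\<not> generalized_digon \<Delta> (Suc i) (Suc (Suc i))"
    if "Suc i < n - 1" "\<Delta> \<in> residues_of_type geom {Suc i, Suc (Suc i)}" for \<Delta> i
    proof -
    have "Suc i \<in> {1..n - 2}" using that(1) by auto
    note transvection_braid[OF this]
    then have "(transvection n (Suc i) \<otimes>\<^bsub>UT n\<^esub> transvection n (Suc (Suc i))) [^]\<^bsub>UT n\<^esub> (4::nat) = \<one>\<^bsub>UT n\<^esub>"
      "(transvection n (Suc i) \<otimes>\<^bsub>UT n\<^esub> transvection n (Suc (Suc i))) [^]\<^bsub>UT n\<^esub> (2::nat) \<noteq> \<one>\<^bsub>UT n\<^esub>"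
      by (simp_all add: One_nat_def)
    then show "cycle_incidence_graph \<Delta> 8" "\<not> generalized_digon \<Delta> (Suc i) (Suc (Suc i))"
      using residue_octagon[of "Suc i" "Suc (Suc i)" \<Delta>] that by auto
  qed
  have linear: "linear_diagram geom [1..<n]"
    unfolding linear_diagram_def
  proof (intro conjI allI impI ballI)
    fix i j \<Delta> assume ij: "i < j \<and> j < length [1..<n]" and D: "\<Delta> \<in> residues_of_type geom {[1..<n] ! i, [1..<n] ! j}"
    have e: "[1..<n] ! i = Suc i" "[1..<n] ! j = Suc j" using ij nth by auto
    show "generalized_digon \<Delta> ([1..<n] ! i) ([1..<n] ! j) \<longleftrightarrow> j \<noteq> Suc i"
    proof (cases "j = Suc i")
      case True
      then show ?thesis using octagon(2)[of i \<Delta>] D ij unfolding e by auto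
    next
      case False
      then show ?thesis using residue_digon[of "Suc i" "Suc j" \<Delta>] D ij unfolding e by auto
    qed
  qed (use assms in \<open>auto simp: geom_simps\<close>)
  have "has_schlaefli_type geom [1..<n] (replicate (n - 2) 4)"
    unfolding has_schlaefli_type_def
  proof (intro conjI allI impI ballI)
    fix k \<Delta> assume k: "k < length (replicate (n - 2) (4::nat))"
      and D: "\<Delta> \<in> residues_of_type geom {[1..<n] ! k, [1..<n] ! Suc k}"
    then have e: "[1..<n] ! k = Suc k" "[1..<n] ! Suc k = Suc (Suc k)" "Suc k < n - 1"
      using nth by auto
    then show "cycle_incidence_graph \<Delta> (2 * replicate (n - 2) 4 ! k)"
      using octagon(1)[OF e(3) D[unfolded e(1,2)]] k by simp
  qed (use linear assms in auto)
  moreover have "abstract_regular_polytope geom"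
    using geom_regular_hypertope linear by (auto simp: abstract_regular_polytope_def)
  moreover have "automorphism_group geom \<cong> coxeter4 n Mod normal_closure (coxeter4 n) (coxeter4_extra n)"
  proof -
    let ?Q = "coxeter4 n Mod normal_closure (coxeter4 n) (coxeter4_extra n)"
    have "UT n \<cong> automorphism_group geom" using transl_iso by (auto simp: is_iso_def)
    then have "automorphism_group geom \<cong> UT n" by (rule iso_sym)
    moreover have "UT n \<cong> ?Q" by (rule UT_iso_coxeter4_quotient)
    ultimately show ?thesis by (rule iso_trans)
  qed
  ultimately show ?thesis unfolding geom by blast
qed

end
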